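(* Let $\mathcal H$ be a complex separable Hilbert space, let $A,B$ be positive invertible bounded linear operators on $\mathcal H$, and let $m,m',M,M'$ be positive real numbers satisfying either $0<m'I\le A\le mI<MI\le B\le M'I$ or $0<m'I\le B\le mI<MI\le A\le M'I$. Let $v\in(0,1)$ and put $h=\frac{M}{m}$, $r=\min\{v,1-v\}$, $r_1=\min\{2r,1-2r\}$ and $\hat r_1=\min\{2r_1,1-2r_1\}$. (I) If $0<v\le\frac12$, then $$A\nabla_v B\ \le\ 2(1-v)(A\nabla B-A\#B)-r_1\bigl(A\#B-2A\#_{\frac34}B+B\bigr)+\mathrm{K}(\sqrt[4]{h},2)^{-\hat r_1}A\#_vB.$$ (II) If $\frac12<v<1$, then $$A\nabla_v B\ \le\ 2v(A\nabla B-A\#B)-r_1\bigl(A\#B-2A\#_{\frac14}B+A\bigr)+\mathrm{K}(\sqrt[4]{h},2)^{-\hat r_1}A\#_vB.$$ Equality holds if and only if $A=B$ and $m=M$.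
   Context: $I$ is the identity operator on $\mathcal H$, and inequalities between self-adjoint operators are in the usual (Loewner) operator order; $mI<MI$ means $m<M$. For positive invertible $A,B$ and $v\in[0,1]$: $A\nabla_v B=(1-v)A+vB$ and $A\#_v B=A^{1/2}(A^{-1/2}BA^{-1/2})^vA^{1/2}$; for $v=\frac12$ one writes $A\nabla B$ and $A\#B$. For $t>0$, $\mathrm{K}(t,2)=\frac{(t+1)^2}{4t}$ denotes the Kantorovich constant.
   Formalization: The equality clause is stated for v ≠ 1/2 (at v = 1/2 the right side of (I) equals A∇B, so equality always holds, e.g. A = I, B = 2I), for a nonzero Hilbert space, and with m ≤ M in place of m < M so that m = M can occur. *)

theory Defs
  imports "HOL-Analysis.Analysis"
begin

section \<open>Complex Hilbert spaces\<close>

text \<open>The inner product is linear in its first argument.  The real vector space structure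
  inherited from \<^class>\<open>real_normed_vector\<close> is the restriction of the complex one to real scalars.\<close>

class complex_inner = real_normed_vector +
  fixes scaleC :: "complex \<Rightarrow> 'a \<Rightarrow> 'a"  (infixr \<open>*\<^sub>C\<close> 75)
    and cinner :: "'a \<Rightarrow> 'a \<Rightarrow> complex"
  assumes scaleC_add_right: "c *\<^sub>C (x + y) = c *\<^sub>C x + c *\<^sub>C y"
    and scaleC_add_left: "(c + d) *\<^sub>C x = c *\<^sub>C x + d *\<^sub>C x"
    and scaleC_scaleC: "c *\<^sub>C d *\<^sub>C x = (c * d) *\<^sub>C x"
    and scaleC_one: "1 *\<^sub>C x = x"
    and scaleR_scaleC: "scaleR r x = complex_of_real r *\<^sub>C x"
    and cinner_commute: "cinner x y = cnj (cinner y x)"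
    and cinner_add_left: "cinner (x + y) z = cinner x z + cinner y z"
    and cinner_scaleC_left: "cinner (c *\<^sub>C x) y = c * cinner x y"
    and norm_sq_cinner: "cinner x x = complex_of_real ((norm x)\<^sup>2)"

class complex_hilbert = complex_inner + complete_space

instantiation complex :: complex_hilbert
begin

definition "scaleC_complex (c::complex) (x::complex) = c * x"
definition "cinner_complex (x::complex) (y::complex) = x * cnj y"

instance
proof
  fix c d x y z :: complex and r :: real
  show "c *\<^sub>C (x + y) = c *\<^sub>C x + c *\<^sub>C y"
    by (simp add: scaleC_complex_def distrib_left)
  show "(c + d) *\<^sub>C x = c *\<^sub>C x + d *\<^sub>C x"
    by (simp add: scaleC_complex_def distrib_right)
  show "c *\<^sub>C d *\<^sub>C x = (c * d) *\<^sub>C x"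
    by (simp add: scaleC_complex_def)
  show "1 *\<^sub>C x = x"
    by (simp add: scaleC_complex_def)
  show "scaleR r x = complex_of_real r *\<^sub>C x"
    by (simp add: scaleC_complex_def scaleR_conv_of_real)
  show "cinner x y = cnj (cinner y x)"
    by (simp add: cinner_complex_def mult.commute)
  show "cinner (x + y) z = cinner x z + cinner y z"
    by (simp add: cinner_complex_def distrib_right)
  show "cinner (c *\<^sub>C x) y = c * cinner x y"
    by (simp add: cinner_complex_def scaleC_complex_def mult.assoc)
  show "cinner x x = complex_of_real ((norm x)\<^sup>2)"
    by (simp only: cinner_complex_def complex_norm_square)
qed

end


section \<open>Bounded operators and the Loewner order\<close>

text \<open>Bounded operators are elements of \<open>'a \<Rightarrow>\<^sub>L 'a\<close> (bounded and \<^emph>\<open>real\<close>-linear)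
  that respect complex scalars; for these the norm of \<open>'a \<Rightarrow>\<^sub>L 'a\<close> is the usual operator norm.\<close>

definition clinear_op :: "('a::complex_inner \<Rightarrow>\<^sub>L 'a) \<Rightarrow> bool" where
  "clinear_op A \<longleftrightarrow> (\<forall>c x. blinfun_apply A (c *\<^sub>C x) = c *\<^sub>C blinfun_apply A x)"

definition selfadjoint_op :: "('a::complex_inner \<Rightarrow>\<^sub>L 'a) \<Rightarrow> bool" where
  "selfadjoint_op A \<longleftrightarrow> clinear_op A \<and>
     (\<forall>x y. cinner (blinfun_apply A x) y = cinner x (blinfun_apply A y))"

definition positive_op :: "('a::complex_inner \<Rightarrow>\<^sub>L 'a) \<Rightarrow> bool" where
  "positive_op A \<longleftrightarrow> selfadjoint_op A \<and> (\<forall>x. 0 \<le> Re (cinner (blinfun_apply A x) x))"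

definition invertible_op :: "('a::complex_inner \<Rightarrow>\<^sub>L 'a) \<Rightarrow> bool" where
  "invertible_op A \<longleftrightarrow> (\<exists>T. T o\<^sub>L A = id_blinfun \<and> A o\<^sub>L T = id_blinfun)"

definition loewner_le :: "('a::complex_inner \<Rightarrow>\<^sub>L 'a) \<Rightarrow> ('a \<Rightarrow>\<^sub>L 'a) \<Rightarrow> bool"  (infix \<open>\<preceq>\<close> 50) where
  "A \<preceq> B \<longleftrightarrow> selfadjoint_op A \<and> selfadjoint_op B \<and> positive_op (B - A)"


section \<open>Continuous functional calculus\<close>

text \<open>The inverse \<open>T\<close> below is automatically complex-linear when \<open>A\<close> is.\<close>

definition op_spectrum :: "('a::complex_inner \<Rightarrow>\<^sub>L 'a) \<Rightarrow> complex set" where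
  "op_spectrum A = {z. \<not> (\<exists>T :: 'a \<Rightarrow>\<^sub>L 'a.
      (\<forall>x. blinfun_apply T (blinfun_apply A x - z *\<^sub>C x) = x) \<and>
      (\<forall>x. blinfun_apply A (blinfun_apply T x) - z *\<^sub>C blinfun_apply T x = x))}"

primrec op_power :: "('a::complex_inner \<Rightarrow>\<^sub>L 'a) \<Rightarrow> nat \<Rightarrow> ('a \<Rightarrow>\<^sub>L 'a)" where
  "op_power A 0 = id_blinfun"
| "op_power A (Suc n) = A o\<^sub>L op_power A n"

definition op_poly :: "real poly \<Rightarrow> ('a::complex_inner \<Rightarrow>\<^sub>L 'a) \<Rightarrow> ('a \<Rightarrow>\<^sub>L 'a)" where
  "op_poly p A = (\<Sum>i\<le>degree p. coeff p i *\<^sub>R op_power A i)"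

text \<open>For self-adjoint \<open>A\<close> (whose spectrum is real) and real-valued \<open>f\<close> continuous on the
  spectrum, \<open>f(A)\<close> is the norm limit of \<open>p\<^sub>n(A)\<close> for any sequence of real polynomials
  \<open>p\<^sub>n\<close> converging to \<open>f\<close> uniformly on the spectrum.\<close>

definition cfc :: "(real \<Rightarrow> real) \<Rightarrow> ('a::complex_hilbert \<Rightarrow>\<^sub>L 'a) \<Rightarrow> ('a \<Rightarrow>\<^sub>L 'a)" where
  "cfc f A = (THE T. \<forall>p :: nat \<Rightarrow> real poly.
      uniform_limit {x. complex_of_real x \<in> op_spectrum A} (\<lambda>n. poly (p n)) f sequentially
        \<longrightarrow> (\<lambda>n. op_poly (p n) A) \<longlonglongrightarrow> T)"

definition op_powr :: "('a::complex_hilbert \<Rightarrow>\<^sub>L 'a) \<Rightarrow> real \<Rightarrow> ('a \<Rightarrow>\<^sub>L 'a)" where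
  "op_powr A s = cfc (\<lambda>x. x powr s) A"


section \<open>Operator means and the Kantorovich constant\<close>

definition arith_mean :: "('a::complex_hilbert \<Rightarrow>\<^sub>L 'a) \<Rightarrow> real \<Rightarrow> ('a \<Rightarrow>\<^sub>L 'a) \<Rightarrow> ('a \<Rightarrow>\<^sub>L 'a)"
    (\<open>_ \<nabla>\<^bsub>_\<^esub> _\<close> [71, 0, 71] 70) where
  "A \<nabla>\<^bsub>v\<^esub> B = (1 - v) *\<^sub>R A + v *\<^sub>R B"

definition geom_mean :: "('a::complex_hilbert \<Rightarrow>\<^sub>L 'a) \<Rightarrow> real \<Rightarrow> ('a \<Rightarrow>\<^sub>L 'a) \<Rightarrow> ('a \<Rightarrow>\<^sub>L 'a)"
    (\<open>_ \<sharp>\<^bsub>_\<^esub> _\<close> [71, 0, 71] 70) where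
  "A \<sharp>\<^bsub>v\<^esub> B =
     op_powr A (1/2) o\<^sub>L op_powr (op_powr A (-1/2) o\<^sub>L B o\<^sub>L op_powr A (-1/2)) v o\<^sub>L op_powr A (1/2)"

text \<open>This is \<open>K(t, 2)\<close>.\<close>

definition kantorovich :: "real \<Rightarrow> real" where
  "kantorovich t = (t + 1)\<^sup>2 / (4 * t)"

end

(* With X = A^{-1/2} B A^{-1/2}, the right side minus the left side is A^{1/2} f(X) A^{1/2} for a scalar
   function f (in case (I), gap below), so the claim is f >= 0 on the spectrum of X, which lies in
   [h, oo) or in (0, 1/h].  Case (II) is case (I) for 1/x and 1 - v.  Put y = sqrt x.  The refined Young
   inequality with a Kantorovich factor K^s, applied to the pair (x, y) with weight 2v, bounds
   2 (1 - v) y - (1 - 2v) x by 2 y - K^s x^(1-v) minus the refinement term, and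
   2 y <= K^s x^(1-v) + K^(-s) x^v by the arithmetic-geometric mean inequality.  For v < 1/2 the last
   step is strict unless x = 1, so f(x) > 0 for x \<noteq> 1; then f(X) = 0 forces X = I, because
   |x - 1| <= d + C f(x) on a compact interval, for every d > 0 and a suitable C.
   The functional calculus rests on ||p(A)|| <= sup |p| over the real spectrum: the extremal value l of
   the quadratic form of p(A) is an approximate eigenvalue, and factoring p - l over the complex numbers
   yields an approximate eigenvalue of A, necessarily real, at which p takes the value l. *)
theory Submission
  imports Defs "HOL-Computational_Algebra.Fundamental_Theorem_Algebra"
begin

section \<open>The scalar inequality\<close>

lemma kantorovich_ge_1: "t > 0 \<Longrightarrow> 1 \<le> kantorovich t"
  using sum_squares_ge_zero[of "t - 1" 0]
  by (simp add: kantorovich_def field_simps power2_eq_square)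

lemma kantorovich_inverse: "t > 0 \<Longrightarrow> kantorovich (1 / t) = kantorovich t"
  by (simp add: kantorovich_def field_simps power2_eq_square)

lemma kantorovich_mono:
  assumes "1 \<le> s" "s \<le> t"
  shows "kantorovich s \<le> kantorovich t"
proof -
  \<comment> \<open>The cross-multiplied difference of the two constants factors, and both factors
    are nonnegative on \<open>[1, \<infinity>)\<close>.\<close>
  have "(t + 1)\<^sup>2 * s - (s + 1)\<^sup>2 * t = (t - s) * (s * t - 1)"
    by algebra
  moreover have "0 \<le> (t - s) * (s * t - 1)"
    using assms mult_mono[of 1 s 1 t] by (intro mult_nonneg_nonneg) auto
  ultimately show ?thesis
    using assms by (simp add: kantorovich_def divide_simps mult.commute)
qed

section \<open>Young inequalities with a Kantorovich factor\<close>

text \<open>With \<open>c\<close> the arithmetic mean of \<open>a\<close> and \<open>b\<close>, the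
  constant at \<open>b / a\<close> equals \<open>c^2 / (a * b)\<close>, so the left side collapses
  to \<open>a powr (1 - 2 * w) * c powr (2 * w)\<close>. The plain weighted Young inequality for
  \<open>a\<close> and \<open>c\<close> with weight \<open>2 * w\<close> then ends exactly at the
  right side; it needs \<open>w \<le> 1/2\<close>.\<close>

lemma young_kantorovich_half:
  fixes a b w :: real
  assumes "a > 0" "b > 0" "0 \<le> w" "w \<le> 1/2"
  shows "kantorovich (b / a) powr w * (a powr (1 - w) * b powr w) \<le> (1 - w) * a + w * b"
proof -
  define c where "c = (a + b) / 2"
  have c: "c > 0" using assms by (simp add: c_def)
  have K: "kantorovich (b / a) = c\<^sup>2 / (a * b)"
    using assms by (simp add: kantorovich_def c_def field_simps power2_eq_square)
  have "kantorovich (b / a) powr w * (a powr (1 - w) * b powr w)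
      = (c\<^sup>2) powr w * (a powr (1 - w) / a powr w)"
    using assms c by (simp add: K powr_divide powr_mult)
  also have "\<dots> = a powr (1 - 2 * w) * c powr (2 * w)"
    using assms c by (simp add: powr_diff[symmetric] powr_powr flip: powr_numeral)
  also have "\<dots> \<le> (1 - 2 * w) * a + 2 * w * c"
    using Youngs_inequality_0[of "1 - 2 * w" "2 * w" a c] assms c by simp
  also have "\<dots> = (1 - w) * a + w * b"
    by (simp add: c_def field_simps)
  finally show ?thesis .
qed

lemma young_kantorovich:
  fixes a b w :: real
  assumes "a > 0" "b > 0" "0 \<le> w" "w \<le> 1"
  shows "kantorovich (b / a) powr min w (1 - w) * (a powr (1 - w) * b powr w) \<le> (1 - w) * a + w * b"
proof (cases "w \<le> 1/2")
  case True
  then show ?thesis using young_kantorovich_half[of a b w] assms by (simp add: min_def)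
next
  case False
  have "kantorovich (a / b) = kantorovich (b / a)"
    using kantorovich_inverse[of "b / a"] assms by simp
  then show ?thesis using young_kantorovich_half[of b a "1 - w"] assms False
    by (simp add: min_def mult.commute add.commute)
qed

text \<open>Apply \<open>young_kantorovich\<close> to \<open>a\<close> and
  \<open>sqrt (a * b)\<close> with weight \<open>2 * w\<close>. The weighted geometric mean is
  unchanged, while the arithmetic mean drops by exactly
  \<open>w * (sqrt a - sqrt b)^2\<close>.\<close>

lemma refined_young_half:
  fixes a b w :: real
  assumes "a > 0" "b > 0" "0 \<le> w" "w \<le> 1/2"
  shows "w * (sqrt a - sqrt b)\<^sup>2
      + kantorovich (sqrt (b / a)) powr min (2 * w) (1 - 2 * w) * (a powr (1 - w) * b powr w)
    \<le> (1 - w) * a + w * b"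
proof -
  define c where "c = sqrt a * sqrt b"
  have c: "c > 0" using assms by (simp add: c_def)
  have "c / a = sqrt (b / a)"
    using assms by (simp add: c_def real_sqrt_divide field_simps)
  moreover have "a powr (1 - 2 * w) * c powr (2 * w) = a powr (1 - w) * b powr w"
    using assms by (simp add: c_def powr_mult powr_half_sqrt[symmetric] powr_powr powr_add[symmetric])
  moreover have "w * (sqrt a - sqrt b)\<^sup>2 = w * a + w * b - 2 * w * c"
    using assms by (simp add: c_def power2_diff algebra_simps)
  ultimately show ?thesis
    using young_kantorovich[of a c "2 * w"] assms c by (simp add: algebra_simps)
qed

text \<open>Exchanging \<open>a\<close> with \<open>b\<close> and \<open>w\<close> with
  \<open>1 - w\<close> preserves everything, because the Kantorovich constant is invariant under
  inversion of its argument.\<close>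

lemma refined_young:
  fixes a b w :: real
  assumes "a > 0" "b > 0" "0 \<le> w" "w \<le> 1" and r: "r = min w (1 - w)"
  shows "r * (sqrt a - sqrt b)\<^sup>2
      + kantorovich (sqrt (b / a)) powr min (2 * r) (1 - 2 * r) * (a powr (1 - w) * b powr w)
    \<le> (1 - w) * a + w * b"
proof (cases "w \<le> 1/2")
  case True
  then show ?thesis using refined_young_half[of a b w] assms by (simp add: min_def)
next
  case False
  have "kantorovich (sqrt (a / b)) = kantorovich (sqrt (b / a))"
    using kantorovich_inverse[of "sqrt (b / a)"] assms by (simp add: real_sqrt_divide)
  moreover have "r = 1 - w" using False r by simp
  ultimately show ?thesis
    using refined_young_half[of b a "1 - w"] assms False
    by (simp add: mult.commute add.commute power2_commute)
qed

section \<open>The scalar functions of cases (I) and (II)\<close>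

text \<open>Right side minus left side of (I) with \<open>A\<close> replaced by 1 and
  \<open>B\<close> by \<open>x\<close>. The coefficient \<open>k\<close> stays free, so that it can
  be the constant belonging to \<open>h\<close> as well as the one belonging to \<open>x\<close>
  itself.\<close>

definition gap :: "real \<Rightarrow> real \<Rightarrow> real \<Rightarrow> real \<Rightarrow> real" where
  "gap v r k x = 2 * (1 - v) * ((1 + x) / 2 - x powr (1/2))
     - r * (x powr (1/2) - 2 * x powr (3/4) + x) + k * x powr v - ((1 - v) + v * x)"

lemma two_geom_mean_le:
  fixes p q :: real
  assumes "p > 0" "q > 0"
  shows "2 * sqrt (p * q) \<le> p + q" and "p \<noteq> q \<Longrightarrow> 2 * sqrt (p * q) < p + q"
proof -
  have eq: "p + q - 2 * sqrt (p * q) = (sqrt p - sqrt q)\<^sup>2"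
    using assms by (simp add: power2_diff real_sqrt_mult)
  show "2 * sqrt (p * q) \<le> p + q"
    using eq zero_le_power2[of "sqrt p - sqrt q"] by linarith
  assume "p \<noteq> q"
  then have "(sqrt p - sqrt q)\<^sup>2 > 0" by simp
  then show "2 * sqrt (p * q) < p + q" using eq by linarith
qed

text \<open>In \<open>gap\<close> the constant terms cancel and \<open>(1 - 2 * v) * x\<close>
  remains as the linear term. The refined Young inequality for \<open>x\<close> and
  \<open>sqrt x\<close> with weight \<open>2 * v\<close> bounds it below, and its square term is
  precisely the one subtracted in \<open>gap\<close>.\<close>

lemma gap_lower_bound:
  fixes v x :: real
  assumes v: "0 < v" "v \<le> 1/2" and x: "x > 0"
    and r1: "r1 = min (2 * v) (1 - 2 * v)" and r1h: "r1h = min (2 * r1) (1 - 2 * r1)"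
    and K: "K = kantorovich (x powr (1/4))"
  shows "K powr r1h * x powr (1 - v) + K powr - r1h * x powr v - 2 * x powr (1/2)
    \<le> gap v r1 (K powr - r1h) x"
proof -
  define y where "y = x powr (1/2)"
  define t where "t = x powr (1/4)"
  have y: "y > 0" and t: "t > 0" using x by (auto simp: y_def t_def)
  have sqrts: "sqrt x = y" "sqrt y = t"
    using x by (auto simp: y_def t_def powr_half_sqrt[symmetric] powr_powr)
  \<comment> \<open>The refined inequality produces the constant at \<open>1 / t\<close>; invariance
    under inversion turns it into \<open>K\<close>.\<close>
  have yx: "sqrt (y / x) = 1 / t"
  proof -
    have "y / x = 1 / y" using sqrts(1) x y by (simp add: field_simps flip: power2_eq_square) auto
    then show ?thesis using sqrts by (simp add: real_sqrt_divide)
  qed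
  have "x powr (1 - 2 * v) * y powr (2 * v) = x powr (1 - v)"
    using x by (simp add: y_def powr_powr powr_add[symmetric])
  moreover have "(sqrt x - sqrt y)\<^sup>2 = y - 2 * x powr (3/4) + x"
  proof -
    have "sqrt x * sqrt y = x powr (3/4)"
      using x by (simp add: sqrts) (simp add: y_def t_def powr_add[symmetric])
    then show ?thesis using x y by (simp add: power2_diff mult.assoc)
  qed
  ultimately have "r1 * (y - 2 * x powr (3/4) + x) + K powr r1h * x powr (1 - v)
      \<le> (1 - 2 * v) * x + 2 * v * y"
    using refined_young[of x y "2 * v" r1] v x y r1 kantorovich_inverse[OF t]
    by (simp add: yx r1h K t_def)
  then show ?thesis
    by (simp add: gap_def y_def[symmetric]) (simp add: field_simps)
qed

lemma kantorovich_less_inverse: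
  assumes "0 < t" "t < 1"
  shows "kantorovich t < 1 / t"
proof -
  have "(t + 1)\<^sup>2 < 2\<^sup>2" using assms by (intro power_strict_mono) auto
  then show ?thesis using assms by (simp add: kantorovich_def divide_simps)
qed

text \<open>This makes the arithmetic-geometric mean step strict. Equality would mean
  \<open>K powr (2 * r1h) * x powr (1 - 2 * v) = 1\<close>: for \<open>x > 1\<close> the left side
  is too large, and for \<open>x < 1\<close> the growth of \<open>K\<close> is beaten by the decay
  of the power of \<open>x\<close>. At \<open>v = 1/2\<close> both terms coincide, so that weight is
  excluded.\<close>

lemma kantorovich_powr_neq:
  fixes v x :: real
  assumes v: "0 < v" "v < 1/2" and x: "x > 0" "x \<noteq> 1"
    and r1: "r1 = min (2 * v) (1 - 2 * v)" and r1h: "r1h = min (2 * r1) (1 - 2 * r1)"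
    and K: "K = kantorovich (x powr (1/4))"
  shows "K powr r1h * x powr (1 - v) \<noteq> K powr - r1h * x powr v"
proof
  assume eq: "K powr r1h * x powr (1 - v) = K powr - r1h * x powr v"
  define t where "t = x powr (1/4)"
  have t: "t > 0" using x by (simp add: t_def)
  have K1: "K \<ge> 1" using kantorovich_ge_1 t by (simp add: K t_def)
  have r0: "0 \<le> r1h" "r1h \<le> 2 * (1 - 2 * v)" using v by (auto simp: r1 r1h min_def)
  have "K powr (2 * r1h) * x powr (1 - 2 * v)
      = (K powr r1h * x powr (1 - v)) * (K powr r1h * x powr - v)"
    by (simp add: algebra_simps flip: powr_add)
  also have "\<dots> = (K powr r1h * K powr - r1h) * (x powr v * x powr - v)"
    unfolding eq by (simp only: mult_ac)
  also have "\<dots> = 1" using K1 x by (simp flip: powr_add)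
  finally have one: "K powr (2 * r1h) * x powr (1 - 2 * v) = 1" .
  show False
  proof (cases "x > 1")
    case True
    have "1 \<le> K powr (2 * r1h)" using K1 r0 by (simp add: ge_one_powr_ge_zero)
    moreover have "1 < x powr (1 - 2 * v)" using True v by simp
    ultimately show False using one mult_mono[of 1 "K powr (2 * r1h)" "x powr (1 - 2 * v)" "x powr (1 - 2 * v)"] by simp
  next
    case False
    then have x1: "x < 1" using x by simp
    then have t1: "t < 1" using x powr_less_mono2[of "1/4" x 1] by (simp add: t_def)
    have x_t: "x powr (1 - 2 * v) = t powr (4 * (1 - 2 * v))" using x by (simp add: t_def powr_powr diff_divide_distrib)
    show False
    \<comment> \<open>Strict monotonicity of \<open>powr\<close> in its base needs a positive
      exponent, and \<open>r1h\<close> vanishes at \<open>v = 1/4\<close>.\<close>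
    proof (cases "r1h = 0")
      case True
      have "x powr (1 - 2 * v) < 1" using x x1 v powr_less_mono2[of "1 - 2 * v" x 1] by simp
      then show False using one True K1 by simp
    next
      case False
      then have "K powr (2 * r1h) < (1 / t) powr (2 * r1h)"
        using r0 kantorovich_less_inverse[OF t t1] K1 by (intro powr_less_mono2) (auto simp: K t_def)
      also have "\<dots> = t powr (- 2 * r1h)" using t by (simp add: powr_divide powr_minus_divide)
      finally have "K powr (2 * r1h) * x powr (1 - 2 * v) < t powr (- 2 * r1h) * t powr (4 * (1 - 2 * v))"
        unfolding x_t using t by simp
      also have "\<dots> = t powr (4 * (1 - 2 * v) - 2 * r1h)" by (simp flip: powr_add)
      \<comment> \<open>The exponent is nonnegative because
        \<open>r1h \<le> 2 * r1 \<le> 2 * (1 - 2 * v)\<close>.\<close>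
      also have "\<dots> \<le> 1" using t t1 r0 by (intro powr_le1) auto
      finally show False using one by simp
    qed
  qed
qed

text \<open>Either \<open>x\<close> or \<open>1 / x\<close> is at least \<open>h\<close>, so the
  constant at \<open>x\<close> dominates the one at \<open>h\<close>. This reduces the claim to the
  bound of \<open>gap_lower_bound\<close>, which is an arithmetic mean minus a geometric mean, up to
  a factor 2.\<close>

lemma gap_nonneg_and_pos:
  fixes v x h :: real
  assumes v: "0 < v" "v \<le> 1/2" and h: "1 \<le> h" and x: "x > 0" "h \<le> x \<or> x \<le> 1 / h"
    and r1: "r1 = min (2 * v) (1 - 2 * v)" and r1h: "r1h = min (2 * r1) (1 - 2 * r1)"
    and k: "k = kantorovich (root 4 h) powr - r1h"
  shows "0 \<le> gap v r1 k x" and "v < 1/2 \<Longrightarrow> x \<noteq> 1 \<Longrightarrow> 0 < gap v r1 k x"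
proof -
  define K where "K = kantorovich (x powr (1/4))"
  define s where "s = root 4 h"
  have s: "s \<ge> 1" "s = h powr (1/4)"
    using h unfolding s_def by (simp, simp add: root_powr_inverse)
  have r0: "0 \<le> r1h" using v by (auto simp: r1 r1h min_def)
  have K1: "K \<ge> 1" using kantorovich_ge_1 x by (simp add: K_def)
  have "kantorovich s \<le> K"
  proof (cases "h \<le> x")
    case True
    then show ?thesis unfolding K_def using h s by (intro kantorovich_mono) (auto intro: powr_mono2)
  next
    case False
    with x have "x \<le> 1 / h" by simp
    then have "h \<le> 1 / x" using x h by (simp add: field_simps)
    then have "s \<le> 1 / x powr (1/4)"
      using powr_mono2[of "1/4" h "1 / x"] h x by (simp add: s powr_divide)
    with kantorovich_mono[of s "1 / x powr (1/4)"] s show ?thesis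
      using kantorovich_inverse[of "x powr (1/4)"] x by (simp add: K_def)
  qed
  moreover have "1 \<le> kantorovich s" using s by (intro kantorovich_ge_1) auto
  \<comment> \<open>The exponent is not positive, so the larger constant gives the smaller
    coefficient.\<close>
  ultimately have "K powr - r1h \<le> k" unfolding k s_def[symmetric]
    using r0 by (intro powr_mono2') auto
  then have "gap v r1 (K powr - r1h) x \<le> gap v r1 k x"
    using x by (simp add: gap_def mult_right_mono)
  moreover note gap_lower_bound[OF v x(1) r1 r1h K_def]
  \<comment> \<open>The two terms have product \<open>x\<close>, so twice their geometric mean is
    the term subtracted in the lower bound.\<close>
  moreover have "2 * sqrt (K powr r1h * x powr (1 - v) * (K powr - r1h * x powr v)) = 2 * x powr (1/2)"
  proof -
    have "K powr r1h * x powr (1 - v) * (K powr - r1h * x powr v)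
      = (K powr r1h * K powr - r1h) * (x powr (1 - v) * x powr v)" by simp
    also have "\<dots> = x" using K1 x by (simp flip: powr_add)
    finally show ?thesis using x by (simp add: powr_half_sqrt)
  qed
  moreover have "0 < K powr r1h * x powr (1 - v)" "0 < K powr - r1h * x powr v" using K1 x by auto
  moreover note two_geom_mean_le[OF this] kantorovich_powr_neq[OF v(1) _ x(1) _ r1 r1h K_def]
  ultimately show "0 \<le> gap v r1 k x" "v < 1/2 \<Longrightarrow> x \<noteq> 1 \<Longrightarrow> 0 < gap v r1 k x"
    by linarith+
qed

text \<open>The right side is the scalar function of case (II). Multiplying by \<open>x\<close> and
  substituting \<open>1 / x\<close> and \<open>1 - v\<close> is the scalar form of exchanging
  \<open>A\<close> and \<open>B\<close>.\<close>

lemma gap_reflect: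
  assumes "x > 0"
  shows "x * gap (1 - v) r k (1 / x) = 2 * v * ((1 + x) / 2 - x powr (1/2))
     - r * (x powr (1/2) - 2 * x powr (1/4) + 1) + k * x powr v - ((1 - v) + v * x)"
proof -
  have "x * (1 / x) powr s = x powr (1 - s)" for s
    using assms by (simp add: powr_divide powr_diff)
  note * = this[of "1/2"] this[of "3/4"] this[of "1 - v"]
  \<comment> \<open>With the powers of \<open>1 / x\<close> replaced by free variables, only an
    identity modulo \<open>x * z = 1\<close> is left.\<close>
  have ring: "x * (2 * (1 - (1 - v)) * ((1 + z) / 2 - p) - r * (p - 2 * q + z) + k * w - ((1 - (1 - v)) + (1 - v) * z))
      = 2 * v * ((1 + x) / 2 - x * p) - r * (x * p - 2 * (x * q) + 1) + k * (x * w) - ((1 - v) + v * x)"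
    if "x * z = 1" for z p q w
    using that by algebra
  show ?thesis
    using ring[of "1 / x" "(1 / x) powr (1/2)" "(1 / x) powr (3/4)" "(1 / x) powr (1 - v)"] assms
    unfolding gap_def * by simp
qed

section \<open>Self-adjoint operators as quadratic forms\<close>

instance complex_hilbert \<subseteq> banach ..

section \<open>The underlying real inner product\<close>

text \<open>For complex-linear operators this real inner product already detects self-adjointness,
  by \<open>selfadjoint_op_iff\<close>, so the later estimates can be carried out over the
  reals.\<close>

definition rinner :: "'a::complex_inner \<Rightarrow> 'a \<Rightarrow> real" where
  "rinner x y = Re (cinner x y)"

lemma rinner_commute: "rinner x y = rinner y x"
  by (simp add: rinner_def cinner_commute[of x y])

lemma rinner_add_left: "rinner (x + y) z = rinner x z + rinner y z"
  by (simp add: rinner_def cinner_add_left)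

lemma rinner_add_right: "rinner z (x + y) = rinner z x + rinner z y"
  by (simp add: rinner_commute[of z] rinner_add_left)

lemma rinner_scaleR_left: "rinner (c *\<^sub>R x) y = c * rinner x y"
  by (simp add: rinner_def scaleR_scaleC cinner_scaleC_left)

lemma rinner_scaleR_right: "rinner y (c *\<^sub>R x) = c * rinner y x"
  by (simp add: rinner_commute[of y] rinner_scaleR_left)

lemma rinner_minus_left: "rinner (- x) y = - rinner x y"
  using rinner_scaleR_left[of "-1" x y] by simp

lemma rinner_diff_left: "rinner (x - y) z = rinner x z - rinner y z"
  using rinner_add_left[of x "- y" z] by (simp add: rinner_minus_left)

lemma rinner_diff_right: "rinner z (x - y) = rinner z x - rinner z y"
  by (simp add: rinner_commute[of z] rinner_diff_left)

lemma rinner_self: "rinner x x = (norm x)\<^sup>2"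
  by (simp add: rinner_def norm_sq_cinner)

lemmas rinner_simps = rinner_add_left rinner_add_right rinner_scaleR_left rinner_scaleR_right
  rinner_diff_left rinner_diff_right

lemma rinner_zero: "rinner 0 x = 0" "rinner x 0 = 0"
  using rinner_scaleR_left[of 0 0 x] rinner_scaleR_right[of x 0 0] by simp_all

text \<open>Cauchy-Schwarz, from the squared norm of
  \<open>norm y *\<^sub>R x - norm x *\<^sub>R y\<close>.\<close>

lemma rinner_le_norm: "rinner x y \<le> norm x * norm y"
proof (cases "x = 0 \<or> y = 0")
  case True
  then show ?thesis by (auto simp: rinner_zero)
next
  case False
  then have p: "norm x * norm y > 0" by simp
  have "0 \<le> rinner (norm y *\<^sub>R x - norm x *\<^sub>R y) (norm y *\<^sub>R x - norm x *\<^sub>R y)"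
    by (simp add: rinner_self)
  also have "\<dots> = 2 * (norm x * norm y) * (norm x * norm y - rinner x y)"
    unfolding rinner_simps unfolding rinner_self rinner_commute[of y x]
    by (simp add: algebra_simps power2_eq_square)
  finally show ?thesis using p by (simp add: zero_le_mult_iff)
qed

lemma abs_rinner_le_norm: "\<bar>rinner x y\<bar> \<le> norm x * norm y"
  using rinner_le_norm[of x y] rinner_le_norm[of "- x" y] by (simp add: rinner_minus_left)

lemma bounded_bilinear_rinner: "bounded_bilinear rinner"
  by (rule bounded_bilinear.intro)
    (auto simp: rinner_simps intro!: exI[of _ 1] abs_rinner_le_norm)

lemmas tendsto_rinner = bounded_bilinear.tendsto[OF bounded_bilinear_rinner]

lemma clinear_opD: "clinear_op A \<Longrightarrow> blinfun_apply A (c *\<^sub>C x) = c *\<^sub>C blinfun_apply A x"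
  by (simp add: clinear_op_def)

lemma rinner_imaginary: "rinner (\<i> *\<^sub>C x) y = - Im (cinner x y)"
  by (simp add: rinner_def cinner_scaleC_left)

lemma rinner_imaginary_right: "rinner x (\<i> *\<^sub>C y) = Im (cinner x y)"
  by (simp add: rinner_commute[of x] rinner_imaginary cinner_commute[of y x])

lemma selfadjoint_op_iff:
  "selfadjoint_op A \<longleftrightarrow> clinear_op A \<and> (\<forall>x y. rinner (blinfun_apply A x) y = rinner x (blinfun_apply A y))"
proof safe
  assume c: "clinear_op A" and r: "\<forall>x y. rinner (blinfun_apply A x) y = rinner x (blinfun_apply A y)"
  show "selfadjoint_op A" unfolding selfadjoint_op_def
  proof (safe)
    fix x y
    \<comment> \<open>Testing against \<open>\<i> *\<^sub>C y\<close> turns the real part into the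
      imaginary part.\<close>
    have "Im (cinner (A x) y) = Im (cinner x (A y))"
      using r[rule_format, of x "\<i> *\<^sub>C y"]
      by (simp only: clinear_opD[OF c] rinner_imaginary_right)
    then show "cinner (A x) y = cinner x (A y)"
      using r[rule_format, of x y] by (simp add: rinner_def complex_eq_iff)
  qed (rule c)
qed (auto simp: selfadjoint_op_def rinner_def)

lemma selfadjoint_op_clinear: "selfadjoint_op A \<Longrightarrow> clinear_op A"
  by (simp add: selfadjoint_op_def)

lemma selfadjoint_op_rinner:
  "selfadjoint_op A \<Longrightarrow> rinner (blinfun_apply A x) y = rinner x (blinfun_apply A y)"
  by (simp add: selfadjoint_op_iff)

lemma scaleC_zero_right: "c *\<^sub>C (0 :: 'a::complex_inner) = 0"
  using scaleC_add_right[of c 0 "0::'a"] by simp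

lemma scaleC_zero_left: "0 *\<^sub>C (x :: 'a::complex_inner) = 0"
  using scaleC_add_left[of 0 0 x] by simp

lemma scaleC_minus_left: "(- c) *\<^sub>C (x :: 'a::complex_inner) = - (c *\<^sub>C x)"
  using scaleC_add_left[of c "- c" x] by (simp add: scaleC_zero_left add_eq_0_iff)

lemma scaleC_minus_right: "c *\<^sub>C (- x :: 'a::complex_inner) = - (c *\<^sub>C x)"
  using scaleC_add_right[of c x "- x"] by (simp add: scaleC_zero_right add_eq_0_iff)

lemma scaleC_diff_right: "c *\<^sub>C (x - y :: 'a::complex_inner) = c *\<^sub>C x - c *\<^sub>C y"
  using scaleC_add_right[of c x "- y"] by (simp add: scaleC_minus_right)

lemma scaleR_scaleC_commute: "a *\<^sub>R c *\<^sub>C (x :: 'a::complex_inner) = c *\<^sub>C a *\<^sub>R x"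
  by (simp add: scaleR_scaleC scaleC_scaleC mult.commute)

lemma norm_scaleC: "norm (c *\<^sub>C x) = cmod c * norm (x :: 'a::complex_inner)"
proof -
  have "cinner x (c *\<^sub>C x) = cnj c * cinner x x"
    by (subst cinner_commute) (simp add: cinner_scaleC_left norm_sq_cinner)
  then have "cinner (c *\<^sub>C x) (c *\<^sub>C x) = c * cnj c * cinner x x"
    by (simp only: cinner_scaleC_left mult.assoc)
  then have "complex_of_real ((norm (c *\<^sub>C x))\<^sup>2) = complex_of_real ((cmod c * norm x)\<^sup>2)"
    by (simp add: norm_sq_cinner power_mult_distrib complex_norm_square[symmetric])
  then show ?thesis by (simp only: of_real_eq_iff) simp
qed

lemma bounded_linear_scaleC: "bounded_linear (\<lambda>x :: 'a::complex_inner. c *\<^sub>C x)"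
  by (rule bounded_linear_intro[of _ "cmod c"])
    (simp_all add: scaleC_add_right scaleR_scaleC_commute norm_scaleC)

lemmas blinfun_simps = blinfun.add_left blinfun.diff_left blinfun.scaleR_left blinfun.minus_left
  blinfun.zero_left blinfun.add_right blinfun.diff_right blinfun.scaleR_right blinfun.zero_right

section \<open>Closure properties of self-adjoint operators\<close>

lemma selfadjoint_op_id: "selfadjoint_op id_blinfun"
  by (simp add: selfadjoint_op_def clinear_op_def)

lemma selfadjoint_op_add: "selfadjoint_op A \<Longrightarrow> selfadjoint_op B \<Longrightarrow> selfadjoint_op (A + B)"
  by (simp add: selfadjoint_op_iff clinear_op_def rinner_simps blinfun_simps scaleC_add_right)

lemma selfadjoint_op_diff: "selfadjoint_op A \<Longrightarrow> selfadjoint_op B \<Longrightarrow> selfadjoint_op (A - B)"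
  by (simp add: selfadjoint_op_iff clinear_op_def rinner_simps blinfun_simps scaleC_diff_right)

lemma selfadjoint_op_scaleR: "selfadjoint_op A \<Longrightarrow> selfadjoint_op (c *\<^sub>R A)"
  by (simp add: selfadjoint_op_iff clinear_op_def rinner_simps blinfun_simps scaleR_scaleC_commute)

lemma selfadjoint_op_compose:
  assumes "selfadjoint_op A" "selfadjoint_op B" "A o\<^sub>L B = B o\<^sub>L A"
  shows "selfadjoint_op (A o\<^sub>L B)"
  unfolding selfadjoint_op_iff
proof safe
  show "clinear_op (A o\<^sub>L B)"
    using assms by (simp add: selfadjoint_op_def clinear_op_def)
  fix x y
  have "rinner (A (B x)) y = rinner x (B (A y))"
    using assms by (simp add: selfadjoint_op_rinner)
  then show "rinner ((A o\<^sub>L B) x) y = rinner x ((A o\<^sub>L B) y)"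
    by (metis assms(3) blinfun_apply_blinfun_compose)
qed

lemma selfadjoint_op_conj:
  assumes "selfadjoint_op R" "selfadjoint_op T"
  shows "selfadjoint_op (R o\<^sub>L T o\<^sub>L R)"
  using assms by (auto simp: selfadjoint_op_iff clinear_op_def)

lemma selfadjoint_op_limit:
  assumes "\<And>n. selfadjoint_op (T n)" "T \<longlonglongrightarrow> L"
  shows "selfadjoint_op L"
  unfolding selfadjoint_op_iff clinear_op_def
proof safe
  have lim: "(\<lambda>n. T n x) \<longlonglongrightarrow> L x" for x
    by (intro tendsto_intros assms)
  show "L (c *\<^sub>C x) = c *\<^sub>C L x" for c x
  proof (rule LIMSEQ_unique[OF lim])
    show "(\<lambda>n. T n (c *\<^sub>C x)) \<longlonglongrightarrow> c *\<^sub>C L x"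
      using bounded_linear.tendsto[OF bounded_linear_scaleC lim, of c x] assms(1)
      by (simp add: selfadjoint_op_def clinear_op_def)
  qed
  show "rinner (L x) y = rinner x (L y)" for x y
  proof (rule LIMSEQ_unique)
    show "(\<lambda>n. rinner (T n x) y) \<longlonglongrightarrow> rinner (L x) y"
      by (intro tendsto_rinner lim tendsto_const)
    show "(\<lambda>n. rinner (T n x) y) \<longlonglongrightarrow> rinner x (L y)"
      unfolding selfadjoint_op_rinner[OF assms(1)] by (intro tendsto_rinner lim tendsto_const)
  qed
qed

section \<open>Norm estimates and approximate eigenvalues from the quadratic form\<close>

text \<open>Polarisation and the parallelogram law bound \<open>rinner (S x) y\<close> by
  \<open>e / 2\<close> times the sum of the squared norms. The norm of \<open>S x\<close> appears on
  taking for \<open>y\<close> the positive multiple of \<open>S x\<close> that has the length of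
  \<open>x\<close>.\<close>

lemma selfadjoint_norm_le:
  assumes S: "selfadjoint_op S" and e: "\<And>x. \<bar>rinner (blinfun_apply S x) x\<bar> \<le> e * (norm x)\<^sup>2"
    and e0: "e \<ge> 0"
  shows "norm S \<le> e"
proof (rule norm_blinfun_bound[OF e0])
  fix x
  show "norm (S x) \<le> e * norm x"
  proof (cases "S x = 0 \<or> x = 0")
    case True
    then show ?thesis using e0 by (auto simp: blinfun_simps)
  next
    case False
    define t where "t = norm x / norm (S x)"
    define y where "y = t *\<^sub>R S x"
    have t: "t > 0" "norm y = norm x" using False by (auto simp: t_def y_def)
    have "4 * rinner (S x) y = rinner (S (x + y)) (x + y) - rinner (S (x - y)) (x - y)"
      by (simp add: blinfun_simps rinner_simps selfadjoint_op_rinner[OF S, of y x] rinner_commute[of y])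
    also have "\<dots> \<le> e * (norm (x + y))\<^sup>2 + e * (norm (x - y))\<^sup>2"
      using e[of "x + y"] e[of "x - y"] by linarith
    also have "\<dots> = 2 * e * ((norm x)\<^sup>2 + (norm y)\<^sup>2)"
      by (simp add: rinner_self[symmetric] rinner_simps algebra_simps)
    finally have "t * (norm (S x))\<^sup>2 \<le> e * (norm x)\<^sup>2"
      by (simp add: y_def[symmetric] t(2)) (simp add: y_def rinner_simps rinner_self)
    then have "norm x * norm (S x) \<le> norm x * (e * norm x)"
      using False by (simp add: t_def power2_eq_square mult_ac)
    then show ?thesis using False by simp
  qed
qed

text \<open>Evaluate the form at \<open>x - P x / \<parallel>P\<parallel>\<close>.\<close>

lemma positive_form_norm_le:
  assumes P: "selfadjoint_op P" and pos: "\<And>x. 0 \<le> rinner (blinfun_apply P x) x"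
  shows "(norm (blinfun_apply P x))\<^sup>2 \<le> norm P * rinner (blinfun_apply P x) x"
proof (cases "P = 0")
  case True
  then show ?thesis by (simp add: blinfun_simps)
next
  case False
  then have nP: "norm P > 0" by simp
  define s where "s = 1 / norm P"
  have "rinner (P (P x)) (P x) \<le> norm (P (P x)) * norm (P x)"
    by (rule rinner_le_norm)
  also have "\<dots> \<le> norm P * norm (P x) * norm (P x)"
    by (intro mult_right_mono norm_blinfun) auto
  finally have *: "rinner (P (P x)) (P x) \<le> norm P * (norm (P x))\<^sup>2"
    by (simp add: power2_eq_square mult_ac)
  have "0 \<le> rinner (P (x - s *\<^sub>R P x)) (x - s *\<^sub>R P x)" by (rule pos)
  also have "\<dots> = rinner (P x) x - 2 * s * (norm (P x))\<^sup>2 + s\<^sup>2 * rinner (P (P x)) (P x)"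
    by (simp add: blinfun_simps rinner_simps rinner_self selfadjoint_op_rinner[OF P, of "P x" x]
      algebra_simps power2_eq_square[of s])
  also have "\<dots> \<le> rinner (P x) x - 2 * s * (norm (P x))\<^sup>2 + s\<^sup>2 * (norm P * (norm (P x))\<^sup>2)"
    using * by (intro add_left_mono mult_left_mono) auto
  also have "\<dots> = rinner (P x) x - s * (norm (P x))\<^sup>2"
    using nP by (simp add: s_def field_simps power2_eq_square[of "norm P"])
  finally show ?thesis using nP by (simp add: s_def field_simps)
qed

text \<open>Failure of this property for \<open>A - z\<close> says that \<open>z\<close> is an
  approximate eigenvalue of \<open>A\<close>. Plain functions are allowed so that complex shifts and
  complex polynomials of \<open>A\<close> are covered.\<close>

definition bounded_below :: "('a::real_normed_vector \<Rightarrow> 'b::real_normed_vector) \<Rightarrow> bool" where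
  "bounded_below f \<longleftrightarrow> (\<exists>c>0. \<forall>x. c * norm x \<le> norm (f x))"

text \<open>The operator \<open>P = l - S\<close> has a nonnegative form, so
  \<open>positive_form_norm_le\<close> makes \<open>P x\<close> small at unit vectors where the form
  of \<open>S\<close> is almost maximal.\<close>

lemma not_bounded_below_sup_form:
  fixes S :: "'a::complex_inner \<Rightarrow>\<^sub>L 'a"
  assumes S: "selfadjoint_op S" and le: "\<And>x. rinner (blinfun_apply S x) x \<le> l * (norm x)\<^sup>2"
    and sup: "\<And>e. e > 0 \<Longrightarrow> \<exists>x. norm x = 1 \<and> l - e < rinner (blinfun_apply S x) x"
  shows "\<not> bounded_below (\<lambda>x. blinfun_apply S x - l *\<^sub>R x)"
proof
  assume "bounded_below (\<lambda>x. S x - l *\<^sub>R x)"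
  then obtain c where c: "c > 0" "\<And>x. c * norm x \<le> norm (S x - l *\<^sub>R x)"
    by (auto simp: bounded_below_def)
  define P where "P = l *\<^sub>R id_blinfun - S"
  have P: "selfadjoint_op P"
    unfolding P_def by (intro selfadjoint_op_diff selfadjoint_op_scaleR selfadjoint_op_id S)
  have Px: "P x = l *\<^sub>R x - S x" for x by (simp add: P_def blinfun_simps)
  have form: "rinner (P x) x = l * (norm x)\<^sup>2 - rinner (S x) x" for x
    by (simp add: Px rinner_simps rinner_self)
  \<comment> \<open>Chosen so that \<open>norm P * e < c^2\<close>; the added 1 keeps the
    denominator positive.\<close>
  define e where "e = c\<^sup>2 / (norm P + 1)"
  have np: "norm P + 1 > 0" by (smt (verit) norm_ge_zero)
  have "e > 0" using c np by (simp add: e_def)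
  then obtain x where x: "norm x = 1" "l - e < rinner (S x) x" using sup by blast
  have "c\<^sup>2 \<le> (norm (P x))\<^sup>2"
    using c(1) c(2)[of x] x(1) by (intro power_mono) (auto simp: Px norm_minus_commute)
  also have "\<dots> \<le> norm P * rinner (P x) x"
    using positive_form_norm_le[OF P] le by (simp add: form)
  also have "\<dots> \<le> norm P * e"
    using x by (intro mult_left_mono) (auto simp: form)
  also have "\<dots> < (norm P + 1) * e" using \<open>e > 0\<close> by simp
  also have "\<dots> = c\<^sup>2" using np by (simp add: e_def)
  finally show False by simp
qed

section \<open>Polynomials of an operator\<close>

lemma op_poly_altdef:
  assumes "degree p \<le> n"
  shows "op_poly p A = (\<Sum>i\<le>n. coeff p i *\<^sub>R op_power A i)"
  unfolding op_poly_def using assms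
  by (intro sum.mono_neutral_left) (auto simp: coeff_eq_0)

lemma blinfun_compose_sum_right: "A o\<^sub>L (\<Sum>i\<in>I. f i) = (\<Sum>i\<in>I. A o\<^sub>L f i)"
  by (rule bounded_bilinear.sum_right[OF bounded_bilinear_blinfun_compose])

lemmas compose_simps = bounded_bilinear.add_left[OF bounded_bilinear_blinfun_compose]
  bounded_bilinear.add_right[OF bounded_bilinear_blinfun_compose]
  bounded_bilinear.diff_left[OF bounded_bilinear_blinfun_compose]
  bounded_bilinear.diff_right[OF bounded_bilinear_blinfun_compose]
  bounded_bilinear.scaleR_left[OF bounded_bilinear_blinfun_compose]
  bounded_bilinear.scaleR_right[OF bounded_bilinear_blinfun_compose]

lemma blinfun_compose_assoc: "A o\<^sub>L B o\<^sub>L C = A o\<^sub>L (B o\<^sub>L C)"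
  by (rule blinfun_eqI) simp

lemma blinfun_compose_id: "A o\<^sub>L id_blinfun = A" "id_blinfun o\<^sub>L A = A"
  by (rule blinfun_eqI, simp)+

lemma op_poly_0 [simp]: "op_poly 0 A = 0"
  by (simp add: op_poly_def)

lemma op_poly_pCons: "op_poly (pCons a p) A = a *\<^sub>R id_blinfun + (A o\<^sub>L op_poly p A)"
proof -
  have "op_poly (pCons a p) A = (\<Sum>i\<le>Suc (degree p). coeff (pCons a p) i *\<^sub>R op_power A i)"
    by (rule op_poly_altdef) (rule degree_pCons_le)
  also have "\<dots> = a *\<^sub>R id_blinfun + (\<Sum>i\<le>degree p. coeff p i *\<^sub>R (A o\<^sub>L op_power A i))"
    by (subst sum.atMost_Suc_shift) simp
  finally show ?thesis by (simp add: op_poly_def blinfun_compose_sum_right compose_simps)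
qed

lemma op_poly_add: "op_poly (p + q) A = op_poly p A + op_poly q A"
proof -
  define n where "n = max (degree p) (degree q)"
  have "degree (p + q) \<le> n" by (simp add: n_def degree_add_le_max)
  then show ?thesis
    by (simp add: op_poly_altdef[of _ n] n_def sum.distrib[symmetric] scaleR_add_left)
qed

lemma op_poly_smult: "op_poly (smult c p) A = c *\<^sub>R op_poly p A"
  by (simp add: op_poly_altdef[of "smult c p" "degree p"] op_poly_def scaleR_sum_right degree_smult_le)

lemma op_poly_diff: "op_poly (p - q) A = op_poly p A - op_poly q A"
  using op_poly_add[of p "smult (-1) q" A] unfolding op_poly_smult by simp

lemma op_poly_mult: "op_poly (p * q) A = op_poly p A o\<^sub>L op_poly q A"
proof (induction p)
  case 0
  then show ?case by (simp add: blinfun_eqI blinfun_simps)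
next
  case (pCons a p)
  then show ?case
    by (simp add: op_poly_add op_poly_smult op_poly_pCons compose_simps blinfun_compose_assoc
      blinfun_compose_id)
qed

lemma op_poly_X: "op_poly [:0, 1:] A = A"
  by (simp add: op_poly_pCons blinfun_compose_id)

lemma op_poly_const: "op_poly [:c:] A = c *\<^sub>R id_blinfun"
  by (simp add: op_poly_pCons)

lemma op_poly_commute: "op_poly p A o\<^sub>L op_poly q A = op_poly q A o\<^sub>L op_poly p A"
  by (metis mult.commute op_poly_mult)

lemma selfadjoint_op_poly:
  assumes "selfadjoint_op A"
  shows "selfadjoint_op (op_poly p A)"
proof (induction p)
  case 0
  show ?case using selfadjoint_op_scaleR[OF assms, of 0] by simp
next
  case (pCons a p)
  have "A o\<^sub>L op_poly p A = op_poly p A o\<^sub>L A"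
    using op_poly_commute[of "[:0, 1:]" A p] by (simp only: op_poly_X)
  with pCons assms show ?case
    by (simp add: op_poly_pCons selfadjoint_op_add selfadjoint_op_scaleR selfadjoint_op_id
      selfadjoint_op_compose)
qed

section \<open>Complex polynomials of an operator and their linear factors\<close>

text \<open>Horner's scheme at a vector. Complex coefficients are required for splitting
  \<open>p - l\<close> into linear factors.\<close>

definition cpoly_op :: "complex poly \<Rightarrow> ('a::complex_inner \<Rightarrow>\<^sub>L 'a) \<Rightarrow> 'a \<Rightarrow> 'a" where
  "cpoly_op q A = fold_coeffs (\<lambda>a f x. a *\<^sub>C x + blinfun_apply A (f x)) q (\<lambda>x. 0)"

lemma cpoly_op_0 [simp]: "cpoly_op 0 A x = 0"
  by (simp add: cpoly_op_def)

lemma cpoly_op_pCons: "cpoly_op (pCons a q) A x = a *\<^sub>C x + blinfun_apply A (cpoly_op q A x)"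
  by (cases "q = 0 \<and> a = 0") (auto simp: cpoly_op_def scaleC_zero_left blinfun_simps)

lemma cpoly_op_of_real:
  "cpoly_op (map_poly complex_of_real p) A x = blinfun_apply (op_poly p A) x"
  by (induction p) (simp_all add: cpoly_op_pCons op_poly_pCons map_poly_pCons blinfun_simps scaleR_scaleC)

lemma cpoly_op_add: "cpoly_op (p + q) A x = cpoly_op p A x + cpoly_op q A x"
  by (induction p q rule: poly_induct2)
    (simp_all add: cpoly_op_pCons scaleC_add_left blinfun_simps algebra_simps)

lemma cpoly_op_smult:
  "clinear_op A \<Longrightarrow> cpoly_op (smult c p) A x = c *\<^sub>C cpoly_op p A x"
  by (induction p)
    (simp_all add: cpoly_op_pCons scaleC_add_right scaleC_scaleC clinear_opD scaleC_zero_right)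

lemma cpoly_op_linear_factor:
  assumes "clinear_op A"
  shows "cpoly_op ([:- z, 1:] * q) A x = blinfun_apply A (cpoly_op q A x) - z *\<^sub>C cpoly_op q A x"
  using cpoly_op_add[of "smult (- z) q" "pCons 0 q" A x]
  by (simp add: cpoly_op_smult[OF assms] cpoly_op_pCons scaleC_zero_left scaleC_minus_left
     scaleC_zero_left cpoly_op_smult[OF assms, of "-z", simplified])

text \<open>A composition of two maps that are bounded below is bounded below. Hence, when a linear
  factor is split off, the failure for \<open>q\<close> is inherited by that factor or by the
  quotient, and induction on the degree finishes.\<close>

lemma root_of_not_bounded_below:
  assumes A: "clinear_op A" and "q \<noteq> 0" "\<not> bounded_below (cpoly_op q A)"
  shows "\<exists>z. poly q z = 0 \<and> \<not> bounded_below (\<lambda>x. blinfun_apply A x - z *\<^sub>C x)"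
  using assms(2,3)
proof (induction "degree q" arbitrary: q)
  case 0
  then obtain c where c: "q = [:c:]" "c \<noteq> 0" by (metis degree_eq_zeroE pCons_0_0)
  then have "bounded_below (cpoly_op q A)"
    by (auto simp: bounded_below_def cpoly_op_pCons blinfun_simps norm_scaleC intro!: exI[of _ "cmod c"])
  with 0 show ?case by simp
next
  case (Suc n)
  then have "\<not> constant (poly q)" by (simp add: constant_degree)
  then obtain z where z: "poly q z = 0" using fundamental_theorem_of_algebra by blast
  then obtain q' where q': "q = [:- z, 1:] * q'" by (auto simp: poly_eq_0_iff_dvd)
  with Suc have "q' \<noteq> 0" by auto
  then have deg: "degree q' = n" using Suc(2) by (simp add: q' degree_mult_eq del: mult_pCons_left)
  show ?case
  proof (cases "bounded_below (\<lambda>x. A x - z *\<^sub>C x)")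
    case False
    then show ?thesis using z by blast
  next
    case True
    then obtain c where c: "c > 0" "\<And>x. c * norm x \<le> norm (A x - z *\<^sub>C x)"
      by (auto simp: bounded_below_def)
    have "\<not> bounded_below (cpoly_op q' A)"
    proof
      assume "bounded_below (cpoly_op q' A)"
      then obtain d where d: "d > 0" "\<And>x. d * norm x \<le> norm (cpoly_op q' A x)"
        by (auto simp: bounded_below_def)
      have "(c * d) * norm x \<le> norm (cpoly_op q A x)" for x
      proof -
        have "c * (d * norm x) \<le> c * norm (cpoly_op q' A x)"
          using c d by (intro mult_left_mono) auto
        also have "\<dots> \<le> norm (cpoly_op q A x)"
          unfolding q' cpoly_op_linear_factor[OF A] by (rule c)
        finally show ?thesis by (simp add: mult.assoc)
      qed
      moreover have "c * d > 0" using c d by simp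
      ultimately show False using Suc.prems(2) unfolding bounded_below_def by blast
    qed
    then show ?thesis using Suc.hyps(1)[OF deg[symmetric] \<open>q' \<noteq> 0\<close>] q' by auto
  qed
qed

section \<open>The real spectrum of a self-adjoint operator\<close>

text \<open>The set on which \<open>cfc\<close> asks for uniform convergence.\<close>

definition real_spectrum :: "('a::complex_inner \<Rightarrow>\<^sub>L 'a) \<Rightarrow> real set" where
  "real_spectrum A = {x. complex_of_real x \<in> op_spectrum A}"

text \<open>A bounded left inverse \<open>T\<close> of \<open>A - z\<close> would provide the lower
  bound \<open>1 / (norm T + 1)\<close>.\<close>

lemma not_bounded_below_in_spectrum:
  assumes "\<not> bounded_below (\<lambda>x. blinfun_apply A x - z *\<^sub>C x)"
  shows "z \<in> op_spectrum A"
proof (rule ccontr)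
  assume "z \<notin> op_spectrum A"
  then obtain T :: "'a \<Rightarrow>\<^sub>L 'a" where T: "\<And>x. T (A x - z *\<^sub>C x) = x"
    unfolding op_spectrum_def by blast
  have np: "norm T + 1 > 0" by (smt (verit) norm_ge_zero)
  have "1 / (norm T + 1) * norm x \<le> norm (A x - z *\<^sub>C x)" for x
  proof -
    have "norm x \<le> norm T * norm (A x - z *\<^sub>C x)"
      using norm_blinfun[of T "A x - z *\<^sub>C x"] T by simp
    also have "\<dots> \<le> (norm T + 1) * norm (A x - z *\<^sub>C x)"
      by (intro mult_right_mono) auto
    finally show ?thesis using np by (simp add: field_simps)
  qed
  moreover have "1 / (norm T + 1) > 0" using np by simp
  ultimately show False using assms unfolding bounded_below_def by blast
qed

text \<open>The form of \<open>A\<close> is real, so the imaginary part of the form of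
  \<open>A - z\<close> is \<open>- Im z * (norm x)^2\<close>; Cauchy-Schwarz bounds its
  modulus.\<close>

lemma bounded_below_nonreal:
  assumes A: "selfadjoint_op A" and z: "Im z \<noteq> 0"
  shows "bounded_below (\<lambda>x. blinfun_apply A x - z *\<^sub>C x)"
proof -
  have "\<bar>Im z\<bar> * norm x \<le> norm (A x - z *\<^sub>C x)" for x
  proof (cases "x = 0")
    case False
    have "cinner (A x) x = cnj (cinner (A x) x)"
      using A cinner_commute[of x "A x"] by (simp add: selfadjoint_op_def)
    then have "Im (cinner (A x) x) = 0" by (simp add: complex_eq_iff)
    then have "Im (cinner (A x + (- z) *\<^sub>C x) x) = - Im z * (norm x)\<^sup>2"
      by (simp add: cinner_add_left cinner_scaleC_left norm_sq_cinner flip: of_real_power)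
    then have "\<bar>Im z\<bar> * (norm x)\<^sup>2 = \<bar>rinner (A x - z *\<^sub>C x) (\<i> *\<^sub>C x)\<bar>"
      by (simp add: rinner_imaginary_right scaleC_minus_left abs_mult)
    also have "\<dots> \<le> norm (A x - z *\<^sub>C x) * norm x"
      using abs_rinner_le_norm[of "A x - z *\<^sub>C x" "\<i> *\<^sub>C x"] by (simp add: norm_scaleC)
    finally show ?thesis using False by (simp add: power2_eq_square)
  qed simp
  then show ?thesis using z unfolding bounded_below_def by (intro exI[of _ "\<bar>Im z\<bar>"]) auto
qed

section \<open>Bounds for polynomials of an operator by their values on the spectrum\<close>

text \<open>The witness \<open>l\<close> is the supremum of the form over the unit sphere;
  \<open>x0\<close> shows that it exceeds \<open>e\<close>.\<close>

lemma sup_form_approx_eigenvalue: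
  assumes S: "selfadjoint_op S" and x0: "e * (norm x0)\<^sup>2 < rinner (blinfun_apply S x0) x0"
  shows "\<exists>l>e. \<not> bounded_below (\<lambda>x. blinfun_apply S x - l *\<^sub>R x)"
proof -
  define Q where "Q = (\<lambda>x. rinner (S x) x) ` {x. norm x = 1}"
  define l where "l = Sup Q"
  have normalise: "rinner (S x) x = rinner (S u) u * (norm x)\<^sup>2 \<and> norm u = 1"
    if "x \<noteq> 0" "u = (1 / norm x) *\<^sub>R x" for x u
    using that by (simp add: blinfun_simps rinner_simps power2_eq_square)
  have bdd: "bdd_above Q" unfolding Q_def
  proof (rule bdd_aboveI2)
    fix x :: 'a assume "x \<in> {x. norm x = 1}"
    then show "rinner (S x) x \<le> norm S"
      using order_trans[OF rinner_le_norm[of "S x" x]] norm_blinfun[of S x] by simp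
  qed
  have le: "rinner (S x) x \<le> l * (norm x)\<^sup>2" for x
  proof (cases "x = 0")
    case False
    then obtain u where u: "rinner (S x) x = rinner (S u) u * (norm x)\<^sup>2" "norm u = 1"
      using normalise by blast
    then have "rinner (S u) u \<le> l" unfolding l_def by (intro cSup_upper bdd) (auto simp: Q_def)
    then show ?thesis unfolding u by (intro mult_right_mono) auto
  qed (simp add: blinfun_simps rinner_zero)
  have "x0 \<noteq> 0" using x0 by (auto simp: blinfun_simps rinner_zero)
  then obtain u where u: "rinner (S x0) x0 = rinner (S u) u * (norm x0)\<^sup>2" "norm u = 1"
    using normalise by blast
  have "e * (norm x0)\<^sup>2 < l * (norm x0)\<^sup>2" using x0 le[of x0] by linarith
  then have "e < l" using \<open>x0 \<noteq> 0\<close> by simp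
  moreover have "\<not> bounded_below (\<lambda>x. S x - l *\<^sub>R x)"
  proof (rule not_bounded_below_sup_form[OF S le])
    fix e :: real assume "e > 0"
    then have "l - e < Sup Q" by (simp add: l_def)
    moreover have "Q \<noteq> {}" using u by (auto simp: Q_def)
    ultimately show "\<exists>x. norm x = 1 \<and> l - e < rinner (S x) x"
      using bdd by (auto simp: less_cSup_iff Q_def)
  qed
  ultimately show ?thesis by blast
qed

lemma poly_map_poly_of_real:
  "poly (map_poly complex_of_real p) (complex_of_real x) = complex_of_real (poly p x)"
  by (induction p) (simp_all add: map_poly_pCons)

text \<open>Spectral mapping for approximate eigenvalues: a linear factor of \<open>p - l\<close>
  must fail to be bounded below, and its root is real because nonreal shifts of \<open>A\<close> are
  bounded below.\<close>

lemma real_spectrum_root: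
  assumes A: "selfadjoint_op A" and p: "p \<noteq> [:l:]"
    and nb: "\<not> bounded_below (\<lambda>x. blinfun_apply (op_poly p A) x - l *\<^sub>R x)"
  shows "\<exists>x \<in> real_spectrum A. poly p x = l"
proof -
  define q where "q = map_poly complex_of_real (p - [:l:])"
  have "q \<noteq> 0" using p by (simp add: q_def map_poly_eq_0_iff)
  moreover have "cpoly_op q A = (\<lambda>x. op_poly p A x - l *\<^sub>R x)"
    by (simp add: fun_eq_iff q_def cpoly_op_of_real op_poly_diff op_poly_const blinfun_simps)
  ultimately obtain z where z: "poly q z = 0" "\<not> bounded_below (\<lambda>x. A x - z *\<^sub>C x)"
    using root_of_not_bounded_below[of A q] A nb by (auto simp: selfadjoint_op_clinear)
  then have "Im z = 0" using bounded_below_nonreal[OF A] by blast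
  then have zr: "z = complex_of_real (Re z)" by (simp add: complex_eq_iff)
  have "poly q (complex_of_real (Re z)) = complex_of_real (poly (p - [:l:]) (Re z))"
    unfolding q_def by (rule poly_map_poly_of_real)
  with z zr have "poly p (Re z) = l" by simp
  moreover have "Re z \<in> real_spectrum A"
    using not_bounded_below_in_spectrum[OF z(2)] zr by (simp add: real_spectrum_def)
  ultimately show ?thesis by blast
qed

lemma real_spectrum_nonempty:
  assumes A: "selfadjoint_op A" and "(x :: 'a::complex_inner) \<noteq> 0"
  shows "real_spectrum (A :: 'a \<Rightarrow>\<^sub>L 'a) \<noteq> {}"
proof -
  \<comment> \<open>One below the Rayleigh quotient at \<open>x\<close>, to obtain a strict
    inequality.\<close>
  define e where "e = rinner (A x) x / (norm x)\<^sup>2 - 1"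
  have "e * (norm x)\<^sup>2 < rinner (A x) x" using assms by (simp add: e_def left_diff_distrib)
  from sup_form_approx_eigenvalue[OF A this] show ?thesis
    using real_spectrum_root[OF A, of "[:0, 1:]"] by (auto simp: op_poly_X)
qed

text \<open>A form value above \<open>e\<close> would give \<open>op_poly p A\<close> an approximate
  eigenvalue \<open>l > e\<close>, which is a value of \<open>p\<close> on the spectrum.\<close>

lemma op_poly_form_le:
  assumes A: "selfadjoint_op A" and le: "\<And>x. x \<in> real_spectrum A \<Longrightarrow> poly p x \<le> e"
  shows "rinner (blinfun_apply (op_poly p A) x) x \<le> e * (norm x)\<^sup>2"
proof (rule ccontr)
  assume "\<not> ?thesis"
  then have gt: "e * (norm x)\<^sup>2 < rinner (op_poly p A x) x" by simp
  then have "x \<noteq> 0" by (auto simp: blinfun_simps rinner_zero)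
  obtain l where l: "l > e" "\<not> bounded_below (\<lambda>x. op_poly p A x - l *\<^sub>R x)"
    using sup_form_approx_eigenvalue[OF selfadjoint_op_poly[OF A] gt] by blast
  have "\<exists>x \<in> real_spectrum A. poly p x = l"
  \<comment> \<open>For the constant polynomial \<open>l\<close> there is no linear factor to use;
    any point of the nonempty spectrum serves.\<close>
  proof (cases "p = [:l:]")
    case True
    then show ?thesis using real_spectrum_nonempty[OF A \<open>x \<noteq> 0\<close>] by auto
  qed (use real_spectrum_root[OF A _ l(2)] in blast)
  with le l show False by force
qed

lemma op_poly_form_ge:
  assumes A: "selfadjoint_op A" and ge: "\<And>x. x \<in> real_spectrum A \<Longrightarrow> e \<le> poly p x"
  shows "e * (norm x)\<^sup>2 \<le> rinner (blinfun_apply (op_poly p A) x) x"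
  using op_poly_form_le[OF A, of "smult (- 1) p" "- e" x] ge
  by (simp only: op_poly_smult blinfun_simps rinner_scaleR_left poly_smult) simp

text \<open>This estimate makes \<open>op_poly\<close> continuous for the supremum norm on the
  spectrum and so carries the passage from polynomials to continuous functions.\<close>

lemma norm_op_poly_le:
  assumes A: "selfadjoint_op A" and "e \<ge> 0" "\<And>x. x \<in> real_spectrum A \<Longrightarrow> \<bar>poly p x\<bar> \<le> e"
  shows "norm (op_poly p A) \<le> e"
proof (rule selfadjoint_norm_le[OF selfadjoint_op_poly[OF A] _ \<open>e \<ge> 0\<close>])
  fix x
  show "\<bar>rinner (op_poly p A x) x\<bar> \<le> e * (norm x)\<^sup>2"
    using op_poly_form_le[OF A, of p e x] op_poly_form_ge[OF A, of "- e" p x] assms(3)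
    by (simp add: abs_le_iff minus_le_iff)
qed

definition form_between :: "real \<Rightarrow> real \<Rightarrow> ('a::complex_inner \<Rightarrow>\<^sub>L 'a) \<Rightarrow> bool" where
  "form_between a b A \<longleftrightarrow> selfadjoint_op A \<and>
     (\<forall>x. a * (norm x)\<^sup>2 \<le> rinner (blinfun_apply A x) x \<and> rinner (blinfun_apply A x) x \<le> b * (norm x)\<^sup>2)"

lemma form_betweenD:
  assumes "form_between a b A"
  shows "selfadjoint_op A" "a * (norm x)\<^sup>2 \<le> rinner (blinfun_apply A x) x"
    "rinner (blinfun_apply A x) x \<le> b * (norm x)\<^sup>2"
  using assms by (auto simp: form_between_def)

text \<open>The equation \<open>P x = y\<close> is the fixed point equation of \<open>x \<mapsto> x - (P x - y) / C\<close>,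
  which is a contraction for \<open>C\<close> large.\<close>

lemma positive_definite_inverse:
  fixes P :: "'a::complex_hilbert \<Rightarrow>\<^sub>L 'a"
  assumes P: "selfadjoint_op P" and c: "c > 0"
    and ge: "\<And>x. c * (norm x)\<^sup>2 \<le> rinner (blinfun_apply P x) x"
  shows "\<exists>T :: 'a \<Rightarrow>\<^sub>L 'a. (\<forall>x. blinfun_apply T (blinfun_apply P x) = x) \<and>
     (\<forall>x. blinfun_apply P (blinfun_apply T x) = x)"
proof -
  \<comment> \<open>As \<open>C \<ge> norm P\<close>, the form of \<open>N\<close> is nonnegative;
    as \<open>C \<ge> c\<close>, the bound \<open>1 - c / C\<close> is nonnegative.\<close>
  define C where "C = norm P + c"
  have C: "C > 0" "c \<le> C" using c by (auto simp: C_def add_nonneg_pos)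
  define N where "N = id_blinfun - (1 / C) *\<^sub>R P"
  have N: "selfadjoint_op N"
    unfolding N_def by (intro selfadjoint_op_diff selfadjoint_op_scaleR selfadjoint_op_id P)
  have form: "rinner (N x) x = (norm x)\<^sup>2 - rinner (P x) x / C" for x
    by (simp add: N_def blinfun_simps rinner_simps rinner_self)
  have "norm N \<le> 1 - c / C"
  proof (rule selfadjoint_norm_le[OF N])
    fix x
    have "rinner (P x) x \<le> norm (P x) * norm x" by (rule rinner_le_norm)
    also have "\<dots> \<le> norm P * norm x * norm x" by (intro mult_right_mono norm_blinfun) auto
    also have "\<dots> \<le> C * norm x * norm x" using c by (intro mult_right_mono) (auto simp: C_def)
    finally have "rinner (P x) x / C \<le> (norm x)\<^sup>2"
      using C by (simp add: field_simps power2_eq_square)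
    moreover have "c / C * (norm x)\<^sup>2 \<le> rinner (P x) x / C"
      using ge[of x] C by (simp add: divide_right_mono)
    ultimately show "\<bar>rinner (N x) x\<bar> \<le> (1 - c / C) * (norm x)\<^sup>2"
      by (simp add: form left_diff_distrib)
  qed (use C c in simp)
  then have N1: "norm N < 1" using C c by (smt (verit) divide_pos_pos)
  \<comment> \<open>Coercivity yields injectivity of \<open>P\<close> and the bound
    \<open>1 / c\<close> for its inverse; linearity of the inverse comes from injectivity.\<close>
  have lower: "c * norm x \<le> norm (P x)" for x
  proof (cases "x = 0")
    case False
    have "c * norm x * norm x \<le> norm (P x) * norm x"
      using order_trans[OF ge rinner_le_norm[of "P x" x]] by (simp add: power2_eq_square mult.assoc)
    then show ?thesis using False by simp
  qed (simp add: blinfun_simps)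
  have inj: "x = x'" if "P x = P x'" for x x'
    using lower[of "x - x'"] that c by (simp add: blinfun_simps mult_le_0_iff)
  have "\<exists>x. P x = y" for y
  proof -
    define f where "f x = x - (1 / C) *\<^sub>R (P x - y)" for x
    have "\<forall>u v. dist (f u) (f v) \<le> norm N * dist u v"
    proof safe
      fix u v
      have "f u - f v = N (u - v)"
        by (simp add: f_def N_def blinfun_simps scaleR_diff_right)
      then show "dist (f u) (f v) \<le> norm N * dist u v"
        using norm_blinfun[of N "u - v"] by (simp add: dist_norm)
    qed
    then obtain x where "f x = x" using banach_fix_type[of "norm N" f] N1 by auto
    then show ?thesis using C by (auto simp: f_def)
  qed
  then obtain g where g: "\<And>y. P (g y) = y" by metis
  have "bounded_linear g"
  proof (rule bounded_linear_intro)
    show "norm (g x) \<le> norm x * (1 / c)" for x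
      using lower[of "g x"] c by (simp add: g field_simps)
  qed (rule inj, simp add: g blinfun_simps)+
  then have "blinfun_apply (Blinfun g) = g" by (rule bounded_linear_Blinfun_apply)
  then show ?thesis using g inj by metis
qed

text \<open>For \<open>l\<close> outside the interval, \<open>A - l\<close> or \<open>l - A\<close>
  is positive definite and thus has a bounded inverse.\<close>

lemma real_spectrum_subset:
  fixes A :: "'a::complex_hilbert \<Rightarrow>\<^sub>L 'a"
  assumes A: "form_between a b A"
  shows "real_spectrum A \<subseteq> {a..b}"
proof (rule subsetI, rule ccontr)
  fix l assume l: "l \<in> real_spectrum A" and "l \<notin> {a..b}"
  then consider "l < a" | "b < l" by fastforce
  then show False
  proof cases
    case 1
    define P where "P = A - l *\<^sub>R id_blinfun"
    have "selfadjoint_op P" unfolding P_def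
      by (intro selfadjoint_op_diff selfadjoint_op_scaleR selfadjoint_op_id form_betweenD[OF A])
    moreover have "(a - l) * (norm x)\<^sup>2 \<le> rinner (P x) x" for x
      using form_betweenD(2)[OF A, of x]
      by (simp add: P_def blinfun_simps rinner_simps rinner_self left_diff_distrib)
    ultimately obtain T :: "'a \<Rightarrow>\<^sub>L 'a" where "\<forall>x. T (P x) = x" "\<forall>x. P (T x) = x"
      using positive_definite_inverse[of P "a - l"] 1 by auto
    then show False using l
      unfolding real_spectrum_def op_spectrum_def
      by (auto simp: P_def blinfun_simps simp flip: scaleR_scaleC)
  next
    case 2
    define P where "P = l *\<^sub>R id_blinfun - A"
    have "selfadjoint_op P" unfolding P_def
      by (intro selfadjoint_op_diff selfadjoint_op_scaleR selfadjoint_op_id form_betweenD[OF A])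
    moreover have "(l - b) * (norm x)\<^sup>2 \<le> rinner (P x) x" for x
      using form_betweenD(3)[OF A, of x]
      by (simp add: P_def blinfun_simps rinner_simps rinner_self left_diff_distrib)
    ultimately obtain T :: "'a \<Rightarrow>\<^sub>L 'a" where "\<forall>x. T (P x) = x" "\<forall>x. P (T x) = x"
      using positive_definite_inverse[of P "l - b"] 2 by auto
    then have "\<forall>x. (- T) (A x - l *\<^sub>R x) = x" "\<forall>x. A ((- T) x) - l *\<^sub>R ((- T) x) = x"
      by (simp_all add: P_def blinfun_simps algebra_simps blinfun.minus_right)
    then show False using l
      unfolding real_spectrum_def op_spectrum_def
      by (auto simp flip: scaleR_scaleC)
  qed
qed

section \<open>Continuous functional calculus\<close>

lemma real_polynomial_approximation:
  fixes f :: "real \<Rightarrow> real"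
  assumes "continuous_on {a..b} f"
  shows "\<exists>p. uniform_limit {a..b} (\<lambda>n. poly (p n)) f sequentially"
proof -
  have "\<exists>p. \<forall>x \<in> {a..b}. \<bar>f x - poly p x\<bar> < 1 / real (Suc n)" for n
  proof -
    obtain g where g: "real_polynomial_function g"
      "\<And>x. x \<in> {a..b} \<Longrightarrow> \<bar>f x - g x\<bar> < 1 / real (Suc n)"
      using Stone_Weierstrass_real_polynomial_function[of "{a..b}" f "1 / real (Suc n)"] assms by auto
    then obtain c k where "g = (\<lambda>x. \<Sum>i\<le>k. c i * x ^ i)"
      unfolding real_polynomial_function_iff_sum by blast
    then have "poly (\<Sum>i\<le>k. monom (c i) i) x = g x" for x
      by (simp add: poly_sum poly_monom)
    then show ?thesis using g(2) by (intro exI[of _ "\<Sum>i\<le>k. monom (c i) i"]) simp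
  qed
  then obtain p where p: "\<And>n x. x \<in> {a..b} \<Longrightarrow> \<bar>f x - poly (p n) x\<bar> < 1 / real (Suc n)"
    by metis
  have "uniform_limit {a..b} (\<lambda>n. poly (p n)) f sequentially"
  proof (rule uniform_limitI)
    fix e :: real assume "e > 0"
    then have "\<forall>\<^sub>F n in sequentially. 1 / real (Suc n) < e"
      using LIMSEQ_inverse_real_of_nat by (intro order_tendstoD) (auto simp: inverse_eq_divide)
    then show "\<forall>\<^sub>F n in sequentially. \<forall>x\<in>{a..b}. dist (poly (p n) x) (f x) < e"
    proof eventually_elim
      case (elim n)
      then show ?case using less_trans[OF p[of _ n]]
        by (simp add: dist_real_def abs_minus_commute del: of_nat_Suc)
    qed
  qed
  then show ?thesis by blast
qed

text \<open>The limit does not depend on the approximating sequence, as the definite description in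
  \<open>cfc\<close> demands.\<close>

lemma op_poly_diff_tendsto_0:
  assumes A: "selfadjoint_op A"
    and p: "uniform_limit (real_spectrum A) (\<lambda>n. poly (p n)) f sequentially"
    and q: "uniform_limit (real_spectrum A) (\<lambda>n. poly (q n)) f sequentially"
  shows "(\<lambda>n. op_poly (p n) A - op_poly (q n) A) \<longlonglongrightarrow> 0"
proof (rule tendstoI)
  fix e :: real assume "e > 0"
  then have e: "e / 4 > 0" by simp
  show "\<forall>\<^sub>F n in sequentially. dist (op_poly (p n) A - op_poly (q n) A) 0 < e"
    using uniform_limitD[OF p e] uniform_limitD[OF q e]
  proof eventually_elim
    case (elim n)
    have "norm (op_poly (p n - q n) A) \<le> e / 2"
    proof (rule norm_op_poly_le[OF A])
      fix x assume "x \<in> real_spectrum A"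
      with elim have "\<bar>poly (p n) x - f x\<bar> < e / 4" "\<bar>poly (q n) x - f x\<bar> < e / 4"
        by (auto simp: dist_real_def)
      then show "\<bar>poly (p n - q n) x\<bar> \<le> e / 2" unfolding poly_diff by linarith
    qed (use \<open>e > 0\<close> in simp)
    then show ?case using \<open>e > 0\<close> by (simp add: op_poly_diff)
  qed
qed

lemma op_poly_convergent:
  fixes A :: "'a::complex_hilbert \<Rightarrow>\<^sub>L 'a"
  assumes A: "selfadjoint_op A"
    and p: "uniform_limit (real_spectrum A) (\<lambda>n. poly (p n)) f sequentially"
  shows "convergent (\<lambda>n. op_poly (p n) A)"
proof -
  have "Cauchy (\<lambda>n. op_poly (p n) A)"
  proof (rule metric_CauchyI)
    fix e :: real assume "e > 0"
    then have "\<forall>\<^sub>F n in sequentially. \<forall>x \<in> real_spectrum A. dist (poly (p n) x) (f x) < e / 4"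
      by (intro uniform_limitD[OF p]) simp
    then obtain n0 where n0: "\<And>n x. n \<ge> n0 \<Longrightarrow> x \<in> real_spectrum A \<Longrightarrow> dist (poly (p n) x) (f x) < e / 4"
      by (auto simp: eventually_sequentially)
    have "norm (op_poly (p n - p m) A) \<le> e / 2" if "n \<ge> n0" "m \<ge> n0" for n m
    proof (rule norm_op_poly_le[OF A])
      fix x assume "x \<in> real_spectrum A"
      with n0 that have "\<bar>poly (p n) x - f x\<bar> < e / 4" "\<bar>poly (p m) x - f x\<bar> < e / 4"
        by (auto simp: dist_real_def)
      then show "\<bar>poly (p n - p m) x\<bar> \<le> e / 2" unfolding poly_diff by linarith
    qed (use \<open>e > 0\<close> in simp)
    then show "\<exists>M. \<forall>m\<ge>M. \<forall>n\<ge>M. dist (op_poly (p m) A) (op_poly (p n) A) < e"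
      using \<open>e > 0\<close> by (intro exI[of _ n0]) (fastforce simp: dist_norm op_poly_diff)
  qed
  then show ?thesis by (rule Cauchy_convergent)
qed

lemma cfc_LIMSEQ:
  fixes A :: "'a::complex_hilbert \<Rightarrow>\<^sub>L 'a"
  assumes A: "form_between a b A" and f: "continuous_on {a..b} f"
    and p: "uniform_limit {a..b} (\<lambda>n. poly (p n)) f sequentially"
  shows "(\<lambda>n. op_poly (p n) A) \<longlonglongrightarrow> cfc f A"
proof -
  note sa = form_betweenD(1)[OF A]
  have pA: "uniform_limit (real_spectrum A) (\<lambda>n. poly (p n)) f sequentially"
    by (rule uniform_limit_on_subset[OF p real_spectrum_subset[OF A]])
  obtain T where T: "(\<lambda>n. op_poly (p n) A) \<longlonglongrightarrow> T"
    using op_poly_convergent[OF sa pA] by (auto simp: convergent_def)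
  have all: "(\<lambda>n. op_poly (q n) A) \<longlonglongrightarrow> T"
    if "uniform_limit (real_spectrum A) (\<lambda>n. poly (q n)) f sequentially" for q
    using tendsto_add[OF op_poly_diff_tendsto_0[OF sa that pA] T] by simp
  \<comment> \<open>The sequence \<open>p\<close> itself forces uniqueness; \<open>all\<close> shows
    that \<open>T\<close> meets the condition.\<close>
  have "cfc f A = T" unfolding cfc_def real_spectrum_def[symmetric]
    by (rule the_equality) (use all pA T LIMSEQ_unique in blast)+
  with T show ?thesis by simp
qed

text \<open>The calculus is developed for functions continuous on the whole interval, which contains
  the real spectrum and on which Weierstrass approximation applies.\<close>

locale functional_calculus =
  fixes A :: "'a::complex_hilbert \<Rightarrow>\<^sub>L 'a" and a b :: real
  assumes bounds: "form_between a b A"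
begin

lemma cfc_approx:
  assumes "continuous_on {a..b} f"
  obtains p where "uniform_limit {a..b} (\<lambda>n. poly (p n)) f sequentially"
    "(\<lambda>n. op_poly (p n) A) \<longlonglongrightarrow> cfc f A"
  using real_polynomial_approximation[OF assms] cfc_LIMSEQ[OF bounds assms] by blast

lemma cfc_eqI:
  assumes "continuous_on {a..b} f" "uniform_limit {a..b} (\<lambda>n. poly (p n)) f sequentially"
    "(\<lambda>n. op_poly (p n) A) \<longlonglongrightarrow> T"
  shows "cfc f A = T"
  using LIMSEQ_unique[OF cfc_LIMSEQ[OF bounds assms(1,2)] assms(3)] .

lemma cfc_poly: "cfc (poly p) A = op_poly p A"
  by (rule cfc_eqI[of _ "\<lambda>_. p"]) (auto intro!: continuous_intros uniform_limitI)

lemma cfc_cong: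
  assumes f: "continuous_on {a..b} f" and eq: "\<And>x. x \<in> {a..b} \<Longrightarrow> f x = g x"
  shows "cfc f A = cfc g A"
proof -
  obtain p where p: "uniform_limit {a..b} (\<lambda>n. poly (p n)) f sequentially"
    "(\<lambda>n. op_poly (p n) A) \<longlonglongrightarrow> cfc f A" using cfc_approx[OF f] .
  have "cfc g A = cfc f A"
  proof (rule cfc_eqI[OF _ _ p(2)])
    show "continuous_on {a..b} g" using f eq continuous_on_cong by metis
    show "uniform_limit {a..b} (\<lambda>n. poly (p n)) g sequentially"
      using p(1) eq by (subst uniform_limit_cong'[where h = g and i = f]) auto
  qed
  then show ?thesis by simp
qed

lemma cfc_const: "cfc (\<lambda>_. c) A = c *\<^sub>R id_blinfun"
  using cfc_poly[of "[:c:]"] by (simp add: op_poly_const poly_pCons[abs_def])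

lemma cfc_id: "cfc (\<lambda>x. x) A = A"
  using cfc_poly[of "[:0, 1:]"] by (simp add: op_poly_X poly_pCons[abs_def])

lemma cfc_add:
  assumes f: "continuous_on {a..b} f" and g: "continuous_on {a..b} g"
  shows "cfc (\<lambda>x. f x + g x) A = cfc f A + cfc g A"
proof -
  obtain p where p: "uniform_limit {a..b} (\<lambda>n. poly (p n)) f sequentially"
    "(\<lambda>n. op_poly (p n) A) \<longlonglongrightarrow> cfc f A" using cfc_approx[OF f] .
  obtain q where q: "uniform_limit {a..b} (\<lambda>n. poly (q n)) g sequentially"
    "(\<lambda>n. op_poly (q n) A) \<longlonglongrightarrow> cfc g A" using cfc_approx[OF g] .
  show ?thesis
    by (rule cfc_eqI[of _ "\<lambda>n. p n + q n"])
      (use uniform_limit_add[OF p(1) q(1)] tendsto_add[OF p(2) q(2)] f g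
       in \<open>simp_all add: op_poly_add poly_add[abs_def] continuous_on_add\<close>)
qed

lemma cfc_mult:
  assumes f: "continuous_on {a..b} f" and g: "continuous_on {a..b} g"
  shows "cfc (\<lambda>x. f x * g x) A = cfc f A o\<^sub>L cfc g A"
proof -
  obtain p where p: "uniform_limit {a..b} (\<lambda>n. poly (p n)) f sequentially"
    "(\<lambda>n. op_poly (p n) A) \<longlonglongrightarrow> cfc f A" using cfc_approx[OF f] .
  obtain q where q: "uniform_limit {a..b} (\<lambda>n. poly (q n)) g sequentially"
    "(\<lambda>n. op_poly (q n) A) \<longlonglongrightarrow> cfc g A" using cfc_approx[OF g] .
  \<comment> \<open>Products of uniform limits converge uniformly when the limits are
    bounded.\<close>
  have bd: "bounded (f ` {a..b})" "bounded (g ` {a..b})"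
    using compact_continuous_image[OF f] compact_continuous_image[OF g]
    by (auto intro: compact_imp_bounded)
  show ?thesis
    by (rule cfc_eqI[of _ "\<lambda>n. p n * q n"])
      (use uniform_lim_mult[OF p(1) q(1) bd]
          bounded_bilinear.tendsto[OF bounded_bilinear_blinfun_compose p(2) q(2)] f g
       in \<open>simp_all add: op_poly_mult poly_mult[abs_def] continuous_on_mult\<close>)
qed

lemma cfc_scaleR:
  assumes "continuous_on {a..b} f"
  shows "cfc (\<lambda>x. c * f x) A = c *\<^sub>R cfc f A"
  using cfc_mult[OF continuous_on_const assms, of c]
  by (simp add: cfc_const compose_simps blinfun_compose_id)

lemma cfc_diff:
  assumes f: "continuous_on {a..b} f" and g: "continuous_on {a..b} g"
  shows "cfc (\<lambda>x. f x - g x) A = cfc f A - cfc g A"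
  using cfc_add[OF f, of "\<lambda>x. (-1) * g x"] cfc_scaleR[OF g, of "-1"] g
  by (simp add: continuous_on_minus)

lemma selfadjoint_cfc:
  assumes "continuous_on {a..b} f"
  shows "selfadjoint_op (cfc f A)"
  using cfc_approx[OF assms] selfadjoint_op_limit[OF selfadjoint_op_poly[OF form_betweenD(1)[OF bounds]]]
  by metis

text \<open>Polynomials uniformly within \<open>d\<close> of \<open>f\<close> are at least
  \<open>- d\<close> on the spectrum, which bounds their forms; the limit keeps the bound.\<close>

lemma cfc_form_nonneg:
  assumes f: "continuous_on {a..b} f" and pos: "\<And>x. x \<in> {a..b} \<Longrightarrow> 0 \<le> f x"
  shows "0 \<le> rinner (blinfun_apply (cfc f A) x) x"
proof (rule field_le_epsilon)
  fix e :: real assume e: "e > 0"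
  \<comment> \<open>An error of \<open>d\<close> costs at most \<open>e\<close> in the form; the
    added 1 covers \<open>x = 0\<close>.\<close>
  define d where "d = e / ((norm x)\<^sup>2 + 1)"
  have np: "(norm x)\<^sup>2 + 1 > 0" by (simp add: add_nonneg_pos)
  have d: "d > 0" using e np by (simp add: d_def)
  have de: "d * (norm x)\<^sup>2 \<le> e" using e np by (simp add: d_def field_simps)
  obtain p where p: "uniform_limit {a..b} (\<lambda>n. poly (p n)) f sequentially"
    "(\<lambda>n. op_poly (p n) A) \<longlonglongrightarrow> cfc f A" using cfc_approx[OF f] .
  have "(\<lambda>n. rinner (op_poly (p n) A x) x) \<longlonglongrightarrow> rinner (cfc f A x) x"
    by (intro tendsto_rinner tendsto_intros p(2))
  moreover have "\<forall>\<^sub>F n in sequentially. - e \<le> rinner (op_poly (p n) A x) x"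
    using uniform_limitD[OF p(1) d]
  proof eventually_elim
    case (elim n)
    have "- d * (norm x)\<^sup>2 \<le> rinner (op_poly (p n) A x) x"
    proof (rule op_poly_form_ge[OF form_betweenD(1)[OF bounds]])
      fix y assume "y \<in> real_spectrum A"
      then have y: "y \<in> {a..b}" using real_spectrum_subset[OF bounds] by blast
      then have "\<bar>poly (p n) y - f y\<bar> < d" using elim by (auto simp: dist_real_def)
      with pos[OF y] show "- d \<le> poly (p n) y" by linarith
    qed
    then show ?case using de by linarith
  qed
  ultimately have "- e \<le> rinner (cfc f A x) x"
    by (rule tendsto_lowerbound) simp
  then show "0 \<le> rinner (cfc f A x) x + e" by simp
qed

end

section \<open>Powers and means of positive operators\<close>

lemma positive_op_iff: "positive_op P \<longleftrightarrow> selfadjoint_op P \<and> (\<forall>x. 0 \<le> rinner (blinfun_apply P x) x)"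
  by (simp add: positive_op_def rinner_def)

lemma form_between_loewner:
  assumes "a *\<^sub>R id_blinfun \<preceq> A" "A \<preceq> b *\<^sub>R id_blinfun"
  shows "form_between a b A"
  using assms
  by (auto simp: form_between_def loewner_le_def positive_op_iff blinfun_simps rinner_simps rinner_self)

lemma loewner_leI:
  assumes "selfadjoint_op L" "positive_op D" "R = L + D"
  shows "L \<preceq> R"
  using assms by (simp add: loewner_le_def positive_op_iff selfadjoint_op_add)

context functional_calculus
begin

lemma cfc_eq_0_imp_id:
  assumes f: "continuous_on {a..b} f" and nonneg: "\<And>x. x \<in> {a..b} \<Longrightarrow> 0 \<le> f x"
    and pos: "\<And>x. x \<in> {a..b} \<Longrightarrow> x \<noteq> 1 \<Longrightarrow> 0 < f x" and zero: "cfc f A = 0"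
  shows "A = id_blinfun"
proof -
  have "norm (A - id_blinfun) \<le> 0 + d" if d: "d > 0" for d
  proof -
    have "\<exists>C. \<forall>x \<in> {a..b}. \<bar>x - 1\<bar> \<le> d + C * f x"
    proof (cases "{a..b} \<inter> {x. d \<le> \<bar>x - 1\<bar>} = {}")
      case True
      then show ?thesis by (intro exI[of _ 0]) force
    next
      case False
      have "compact ({a..b} \<inter> {x. d \<le> \<bar>x - 1\<bar>})"
        by (intro compact_Int_closed closed_Collect_le continuous_intros compact_Icc)
      \<comment> \<open>The minimum of \<open>f\<close> over the points at distance at least
        \<open>d\<close> from 1 is positive, and it fixes the constant \<open>C\<close>.\<close>
      then obtain z where z: "z \<in> {a..b}" "d \<le> \<bar>z - 1\<bar>"
        and zmin: "\<And>x. x \<in> {a..b} \<Longrightarrow> d \<le> \<bar>x - 1\<bar> \<Longrightarrow> f z \<le> f x"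
        using continuous_attains_inf[OF _ False, of f] continuous_on_subset[OF f] by blast
      have fz: "f z > 0" using pos[OF z(1)] z(2) d by auto
      have "\<bar>x - 1\<bar> \<le> d + (\<bar>a\<bar> + \<bar>b\<bar> + 1) / f z * f x" if x: "x \<in> {a..b}" for x
      proof (cases "d \<le> \<bar>x - 1\<bar>")
        case True
        have "\<bar>x - 1\<bar> \<le> (\<bar>a\<bar> + \<bar>b\<bar> + 1) / f z * f z" using x fz by auto
        also have "\<dots> \<le> (\<bar>a\<bar> + \<bar>b\<bar> + 1) / f z * f x"
          using zmin[OF x True] fz by (intro mult_left_mono) auto
        finally show ?thesis using d by linarith
      next
        case False
        have "0 \<le> (\<bar>a\<bar> + \<bar>b\<bar> + 1) / f z * f x" using nonneg[OF x] fz by auto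
        with False show ?thesis by linarith
      qed
      then show ?thesis by blast
    qed
    then obtain C where C: "\<And>x. x \<in> {a..b} \<Longrightarrow> \<bar>x - 1\<bar> \<le> d + C * f x" by blast
    \<comment> \<open>The signs \<open>\<sigma> = 1\<close> and \<open>\<sigma> = - 1\<close> give
      both halves of the absolute value; the term with \<open>C\<close> disappears because
      \<open>cfc f A = 0\<close>.\<close>
    have *: "\<sigma> * rinner ((A - id_blinfun) x) x \<le> d * (norm x)\<^sup>2" if \<sigma>: "\<bar>\<sigma>\<bar> = 1" for \<sigma> x
    proof -
      have "0 \<le> rinner (cfc (\<lambda>x. (d + C * f x) - \<sigma> * (x - 1)) A x) x"
      proof (rule cfc_form_nonneg)
        fix x assume "x \<in> {a..b}"
        moreover have "\<sigma> * (x - 1) \<le> \<bar>x - 1\<bar>" using \<sigma> abs_ge_self[of "\<sigma> * (x - 1)"] by (simp add: abs_mult)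
        ultimately show "0 \<le> (d + C * f x) - \<sigma> * (x - 1)" using C[of x] by linarith
      qed (intro continuous_intros f)
      also have "cfc (\<lambda>x. (d + C * f x) - \<sigma> * (x - 1)) A = d *\<^sub>R id_blinfun - \<sigma> *\<^sub>R (A - id_blinfun)"
        using f by (simp add: cfc_diff cfc_add cfc_scaleR cfc_const cfc_id zero continuous_intros)
      finally show ?thesis by (simp add: blinfun_simps rinner_simps rinner_self)
    qed
    show ?thesis
    proof (simp, rule selfadjoint_norm_le)
      show "selfadjoint_op (A - id_blinfun)"
        by (intro selfadjoint_op_diff selfadjoint_op_id form_betweenD(1)[OF bounds])
      fix x
      show "\<bar>rinner ((A - id_blinfun) x) x\<bar> \<le> d * (norm x)\<^sup>2"
        using *[of 1 x] *[of "- 1" x] by (simp add: abs_le_iff)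
    qed (use d in simp)
  qed
  then have "norm (A - id_blinfun) \<le> 0" by (rule field_le_epsilon)
  then show ?thesis by simp
qed

end

section \<open>Real powers of a positive definite operator\<close>

locale functional_calculus_pos = functional_calculus +
  assumes a_pos: "a > 0"
begin

lemma continuous_powr: "continuous_on {a..b} (\<lambda>x. x powr s)"
  using a_pos by (intro continuous_intros) auto

lemma op_powr_mult: "op_powr A s o\<^sub>L op_powr A t = op_powr A (s + t)"
  unfolding op_powr_def cfc_mult[OF continuous_powr continuous_powr, symmetric]
  by (simp add: powr_add)

lemma op_powr_0: "op_powr A 0 = id_blinfun"
proof -
  have "cfc (\<lambda>x. x powr 0) A = cfc (\<lambda>x. 1) A"
    using a_pos by (intro cfc_cong continuous_powr) auto
  then show ?thesis by (simp add: op_powr_def cfc_const)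
qed

lemma op_powr_1: "op_powr A 1 = A"
proof -
  have "cfc (\<lambda>x. x powr 1) A = cfc (\<lambda>x. x) A"
    using a_pos by (intro cfc_cong continuous_powr) auto
  then show ?thesis by (simp add: op_powr_def cfc_id)
qed

lemma op_powr_half: "op_powr A (1/2) o\<^sub>L op_powr A (1/2) = A"
  "op_powr A (1/2) o\<^sub>L op_powr A (- (1/2)) = id_blinfun"
  "op_powr A (- (1/2)) o\<^sub>L op_powr A (1/2) = id_blinfun"
  by (simp_all add: op_powr_mult op_powr_0 op_powr_1)

lemma op_powr_half_apply:
  "op_powr A (1/2) (op_powr A (1/2) x) = A x"
  "op_powr A (1/2) (op_powr A (- (1/2)) x) = x"
  "op_powr A (- (1/2)) (op_powr A (1/2) x) = x"
  using op_powr_half by (metis blinfun_apply_blinfun_compose blinfun_apply_id_blinfun)+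

lemma selfadjoint_op_powr: "selfadjoint_op (op_powr A s)"
  unfolding op_powr_def by (rule selfadjoint_cfc[OF continuous_powr])

text \<open>The squared norm is the form of the inverse of \<open>A\<close>, and
  \<open>1 / y\<close> lies between \<open>1 / b\<close> and \<open>1 / a\<close> on the
  interval.\<close>

lemma norm_op_powr_minus_half:
  "(1 / b) * (norm x)\<^sup>2 \<le> (norm (op_powr A (- (1/2)) x))\<^sup>2"
  "(norm (op_powr A (- (1/2)) x))\<^sup>2 \<le> (1 / a) * (norm x)\<^sup>2"
proof -
  have eq: "(norm (op_powr A (- (1/2)) x))\<^sup>2 = rinner (op_powr A (-1) x) x"
    using selfadjoint_op_rinner[OF selfadjoint_op_powr, of "- (1/2)" "op_powr A (- (1/2)) x" x]
      op_powr_mult[of "- (1/2)" "- (1/2)"]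
    by (simp add: rinner_self flip: blinfun_apply_blinfun_compose)
  have inv: "1 / b \<le> y powr -1 \<and> y powr -1 \<le> 1 / a" if "y \<in> {a..b}" for y
    using that a_pos by (auto simp: powr_minus_divide frac_le)
  have "0 \<le> rinner (cfc (\<lambda>y. y powr -1 - 1 / b) A x) x"
    using inv by (intro cfc_form_nonneg continuous_on_diff continuous_powr continuous_on_const) auto
  also have "cfc (\<lambda>y. y powr -1 - 1 / b) A = op_powr A (-1) - (1 / b) *\<^sub>R id_blinfun"
    by (simp only: op_powr_def cfc_diff continuous_powr continuous_on_const cfc_const)
  finally show "(1 / b) * (norm x)\<^sup>2 \<le> (norm (op_powr A (- (1/2)) x))\<^sup>2"
    by (simp add: blinfun_simps rinner_simps rinner_self eq)
  have "0 \<le> rinner (cfc (\<lambda>y. 1 / a - y powr -1) A x) x"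
    using inv by (intro cfc_form_nonneg continuous_on_diff continuous_powr continuous_on_const) auto
  also have "cfc (\<lambda>y. 1 / a - y powr -1) A = (1 / a) *\<^sub>R id_blinfun - op_powr A (-1)"
    by (simp only: op_powr_def cfc_diff continuous_powr continuous_on_const cfc_const)
  finally show "(norm (op_powr A (- (1/2)) x))\<^sup>2 \<le> (1 / a) * (norm x)\<^sup>2"
    by (simp add: blinfun_simps rinner_simps rinner_self eq)
qed

end

lemma op_powr_id_blinfun: "op_powr (id_blinfun :: 'a::complex_hilbert \<Rightarrow>\<^sub>L 'a) s = id_blinfun"
proof -
  interpret functional_calculus_pos "id_blinfun :: 'a \<Rightarrow>\<^sub>L 'a" 1 1
    by unfold_locales (simp_all add: form_between_def selfadjoint_op_id rinner_self)
  have "cfc (\<lambda>x. x powr s) id_blinfun = cfc (\<lambda>_. 1) (id_blinfun :: 'a \<Rightarrow>\<^sub>L 'a)"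
    by (rule cfc_cong[OF continuous_powr]) simp
  then show ?thesis by (simp add: op_powr_def cfc_const)
qed

section \<open>Reduction of means of two operators to functions of one\<close>

locale positive_pair = A: functional_calculus_pos A a b
  for A :: "'a::complex_hilbert \<Rightarrow>\<^sub>L 'a" and a b :: real +
  fixes B :: "'a \<Rightarrow>\<^sub>L 'a" and c d :: real
  assumes B_bounds: "form_between c d B" and c_pos: "c > 0"
    and b_pos: "b > 0" and d_pos: "d > 0"
begin

definition X :: "'a \<Rightarrow>\<^sub>L 'a" where
  "X = op_powr A (- (1/2)) o\<^sub>L B o\<^sub>L op_powr A (- (1/2))"

text \<open>The form of \<open>X\<close> at \<open>x\<close> is the form of \<open>B\<close> at
  \<open>op_powr A (- (1/2)) x\<close>, whose norm has just been estimated.\<close>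

lemma form_between_X: "form_between (c / b) (d / a) X"
  unfolding form_between_def
proof safe
  show "selfadjoint_op X"
    unfolding X_def by (intro selfadjoint_op_conj A.selfadjoint_op_powr form_betweenD[OF B_bounds])
  fix x
  let ?y = "op_powr A (- (1/2)) x"
  have eq: "rinner (X x) x = rinner (B ?y) ?y"
    by (simp add: X_def selfadjoint_op_rinner[OF A.selfadjoint_op_powr])
  have "c / b * (norm x)\<^sup>2 \<le> c * (norm ?y)\<^sup>2"
    using mult_left_mono[OF A.norm_op_powr_minus_half(1)[of x], of c] c_pos by simp
  also have "\<dots> \<le> rinner (X x) x"
    unfolding eq by (rule form_betweenD[OF B_bounds])
  finally show "c / b * (norm x)\<^sup>2 \<le> rinner (X x) x" .
  have "rinner (X x) x \<le> d * (norm ?y)\<^sup>2"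
    unfolding eq by (rule form_betweenD[OF B_bounds])
  also have "\<dots> \<le> d / a * (norm x)\<^sup>2"
    using mult_left_mono[OF A.norm_op_powr_minus_half(2)[of x], of d] d_pos by simp
  finally show "rinner (X x) x \<le> d / a * (norm x)\<^sup>2" .
qed

sublocale X: functional_calculus_pos X "c / b" "d / a"
  using form_between_X b_pos c_pos by unfold_locales auto

lemma geom_mean_X: "A \<sharp>\<^bsub>s\<^esub> B = op_powr A (1/2) o\<^sub>L op_powr X s o\<^sub>L op_powr A (1/2)"
  by (simp add: geom_mean_def X_def)

lemma conj_X: "op_powr A (1/2) o\<^sub>L X o\<^sub>L op_powr A (1/2) = B"
  by (rule blinfun_eqI) (simp add: X_def A.op_powr_half_apply)

lemma combination_eq_conj:
  assumes f: "\<And>x. f x = c0 + c1 * x + c2 * x powr s2 + c3 * x powr s3 + c4 * x powr s4"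
  shows "c0 *\<^sub>R A + c1 *\<^sub>R B + c2 *\<^sub>R (A \<sharp>\<^bsub>s2\<^esub> B) + c3 *\<^sub>R (A \<sharp>\<^bsub>s3\<^esub> B) + c4 *\<^sub>R (A \<sharp>\<^bsub>s4\<^esub> B)
    = op_powr A (1/2) o\<^sub>L cfc f X o\<^sub>L op_powr A (1/2)"
    and "continuous_on {c / b..d / a} f"
proof -
  have f': "f = (\<lambda>x. c0 + c1 * x + c2 * x powr s2 + c3 * x powr s3 + c4 * x powr s4)"
    using f by blast
  show "continuous_on {c / b..d / a} f"
    unfolding f' by (intro continuous_on_add continuous_on_mult continuous_on_const X.continuous_powr continuous_on_id)
  have "cfc f X = c0 *\<^sub>R id_blinfun + c1 *\<^sub>R X + c2 *\<^sub>R op_powr X s2 + c3 *\<^sub>R op_powr X s3 + c4 *\<^sub>R op_powr X s4"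
    unfolding f' op_powr_def
    by (simp add: X.cfc_add X.cfc_scaleR X.cfc_const X.cfc_id X.continuous_powr
        continuous_on_add continuous_on_mult continuous_on_const continuous_on_id)
  then show "c0 *\<^sub>R A + c1 *\<^sub>R B + c2 *\<^sub>R (A \<sharp>\<^bsub>s2\<^esub> B) + c3 *\<^sub>R (A \<sharp>\<^bsub>s3\<^esub> B) + c4 *\<^sub>R (A \<sharp>\<^bsub>s4\<^esub> B)
    = op_powr A (1/2) o\<^sub>L cfc f X o\<^sub>L op_powr A (1/2)"
    by (simp add: compose_simps geom_mean_X conj_X blinfun_compose_id A.op_powr_half)
qed

lemma positive_combination:
  assumes f: "\<And>x. f x = c0 + c1 * x + c2 * x powr s2 + c3 * x powr s3 + c4 * x powr s4"
    and nonneg: "\<And>x. x \<in> {c / b..d / a} \<Longrightarrow> 0 \<le> f x"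
  shows "positive_op (c0 *\<^sub>R A + c1 *\<^sub>R B + c2 *\<^sub>R (A \<sharp>\<^bsub>s2\<^esub> B) + c3 *\<^sub>R (A \<sharp>\<^bsub>s3\<^esub> B) + c4 *\<^sub>R (A \<sharp>\<^bsub>s4\<^esub> B))"
  unfolding combination_eq_conj(1)[OF f] positive_op_iff
proof safe
  note cont = combination_eq_conj(2)[OF f]
  show "selfadjoint_op (op_powr A (1/2) o\<^sub>L cfc f X o\<^sub>L op_powr A (1/2))"
    by (intro selfadjoint_op_conj A.selfadjoint_op_powr X.selfadjoint_cfc cont)
  show "0 \<le> rinner ((op_powr A (1/2) o\<^sub>L cfc f X o\<^sub>L op_powr A (1/2)) x) x" for x
    using X.cfc_form_nonneg[OF cont nonneg, of "op_powr A (1/2) x"]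
    by (simp add: selfadjoint_op_rinner[OF A.selfadjoint_op_powr])
qed

text \<open>The invertible square roots cancel, leaving \<open>cfc f X = 0\<close>; then
  \<open>X\<close> is the identity, and congruence back gives \<open>B = A\<close>.\<close>

lemma combination_eq_0_imp_eq:
  assumes f: "\<And>x. f x = c0 + c1 * x + c2 * x powr s2 + c3 * x powr s3 + c4 * x powr s4"
    and nonneg: "\<And>x. x \<in> {c / b..d / a} \<Longrightarrow> 0 \<le> f x"
    and pos: "\<And>x. x \<in> {c / b..d / a} \<Longrightarrow> x \<noteq> 1 \<Longrightarrow> 0 < f x"
    and zero: "c0 *\<^sub>R A + c1 *\<^sub>R B + c2 *\<^sub>R (A \<sharp>\<^bsub>s2\<^esub> B) + c3 *\<^sub>R (A \<sharp>\<^bsub>s3\<^esub> B) + c4 *\<^sub>R (A \<sharp>\<^bsub>s4\<^esub> B) = 0"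
  shows "A = B"
proof -
  let ?S = "op_powr A (1/2)" and ?R = "op_powr A (- (1/2))"
  have S0: "?S o\<^sub>L cfc f X o\<^sub>L ?S = 0" using zero combination_eq_conj(1)[OF f] by simp
  have "cfc f X x = 0" for x
  proof -
    have "?S (cfc f X (?S (?R x))) = 0" using arg_cong[OF S0, of "\<lambda>T. T (?R x)"] by (simp add: blinfun_simps)
    then have "?R (?S (cfc f X x)) = ?R 0" by (simp add: A.op_powr_half_apply)
    then show ?thesis by (simp add: A.op_powr_half_apply blinfun_simps)
  qed
  then have "cfc f X = 0" by (intro blinfun_eqI) (simp add: blinfun_simps)
  from X.cfc_eq_0_imp_id[OF combination_eq_conj(2)[OF f] nonneg pos this]
  have "X = id_blinfun" by simp
  then show "A = B" using conj_X by (simp add: blinfun_compose_id A.op_powr_half)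
qed

lemma geom_mean_self:
  assumes "A = B"
  shows "A \<sharp>\<^bsub>s\<^esub> B = A"
proof -
  have "X = op_powr A (- (1/2)) o\<^sub>L (op_powr A (1/2) o\<^sub>L op_powr A (1/2)) o\<^sub>L op_powr A (- (1/2))"
    unfolding X_def A.op_powr_half(1) by (simp only: assms)
  also have "\<dots> = id_blinfun"
    by (rule blinfun_eqI) (simp add: A.op_powr_half_apply)
  finally show ?thesis
    by (simp add: geom_mean_X op_powr_id_blinfun blinfun_compose_id A.op_powr_half)
qed

lemma selfadjoint_arith_mean: "selfadjoint_op (A \<nabla>\<^bsub>v\<^esub> B)"
  unfolding arith_mean_def
  by (intro selfadjoint_op_add selfadjoint_op_scaleR form_betweenD[OF A.bounds] form_betweenD[OF B_bounds])

section \<open>The two operator inequalities\<close>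

lemma reverse_young_low:
  fixes v h :: real
  assumes v: "0 < v" "v \<le> 1/2" and h: "1 \<le> h"
    and range: "\<And>x. x \<in> {c / b..d / a} \<Longrightarrow> h \<le> x \<or> x \<le> 1 / h"
    and r1: "r1 = min (2 * v) (1 - 2 * v)" and r1h: "r1h = min (2 * r1) (1 - 2 * r1)"
    and k: "k = kantorovich (root 4 h) powr - r1h"
    and rhs: "rhs = (2 * (1 - v)) *\<^sub>R (A \<nabla>\<^bsub>1/2\<^esub> B - A \<sharp>\<^bsub>1/2\<^esub> B)
            - r1 *\<^sub>R (A \<sharp>\<^bsub>1/2\<^esub> B - 2 *\<^sub>R (A \<sharp>\<^bsub>3/4\<^esub> B) + B) + k *\<^sub>R (A \<sharp>\<^bsub>v\<^esub> B)"
  shows "A \<nabla>\<^bsub>v\<^esub> B \<preceq> rhs" and "v < 1/2 \<Longrightarrow> A \<nabla>\<^bsub>v\<^esub> B = rhs \<Longrightarrow> A = B"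
proof -
  \<comment> \<open>The difference of the two sides with coefficients collected; the multiples of
    \<open>A\<close> cancel.\<close>
  let ?D = "0 *\<^sub>R A + (1 - 2 * v - r1) *\<^sub>R B + (- 2 * (1 - v) - r1) *\<^sub>R (A \<sharp>\<^bsub>1/2\<^esub> B)
    + (2 * r1) *\<^sub>R (A \<sharp>\<^bsub>3/4\<^esub> B) + k *\<^sub>R (A \<sharp>\<^bsub>v\<^esub> B)"
  have f: "gap v r1 k x = 0 + (1 - 2 * v - r1) * x + (- 2 * (1 - v) - r1) * x powr (1/2)
      + (2 * r1) * x powr (3/4) + k * x powr v" for x
    by (simp add: gap_def field_simps)
  have D: "rhs = A \<nabla>\<^bsub>v\<^esub> B + ?D"
    unfolding rhs arith_mean_def by (simp add: algebra_simps flip: scaleR_add_left)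
  have range_pos: "x > 0" if "x \<in> {c / b..d / a}" for x
    using that c_pos b_pos by (auto intro: less_le_trans[of 0 "c / b"])
  note gap = gap_nonneg_and_pos[OF v h range_pos range r1 r1h k]
  show "A \<nabla>\<^bsub>v\<^esub> B \<preceq> rhs"
    by (rule loewner_leI[OF selfadjoint_arith_mean positive_combination[OF f] D]) (rule gap)
  assume "v < 1/2" "A \<nabla>\<^bsub>v\<^esub> B = rhs"
  then have "?D = 0" using D by simp
  then show "A = B" using gap \<open>v < 1/2\<close> by (intro combination_eq_0_imp_eq[OF f])
qed

text \<open>The scalar function equals \<open>x * gap (1 - v) r1 k (1 / x)\<close>, and the
  condition on the range of \<open>x\<close> is symmetric under inversion. Since
  \<open>1 - v < 1/2\<close>, positivity away from 1 is always available.\<close>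

lemma reverse_young_high:
  fixes v h :: real
  assumes v: "1/2 < v" "v < 1" and h: "1 \<le> h"
    and range: "\<And>x. x \<in> {c / b..d / a} \<Longrightarrow> h \<le> x \<or> x \<le> 1 / h"
    and r1: "r1 = min (2 * (1 - v)) (1 - 2 * (1 - v))" and r1h: "r1h = min (2 * r1) (1 - 2 * r1)"
    and k: "k = kantorovich (root 4 h) powr - r1h"
    and rhs: "rhs = (2 * v) *\<^sub>R (A \<nabla>\<^bsub>1/2\<^esub> B - A \<sharp>\<^bsub>1/2\<^esub> B)
            - r1 *\<^sub>R (A \<sharp>\<^bsub>1/2\<^esub> B - 2 *\<^sub>R (A \<sharp>\<^bsub>1/4\<^esub> B) + A) + k *\<^sub>R (A \<sharp>\<^bsub>v\<^esub> B)"
  shows "A \<nabla>\<^bsub>v\<^esub> B \<preceq> rhs" and "A \<nabla>\<^bsub>v\<^esub> B = rhs \<Longrightarrow> A = B"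
proof -
  let ?D = "(2 * v - 1 - r1) *\<^sub>R A + 0 *\<^sub>R B + (- 2 * v - r1) *\<^sub>R (A \<sharp>\<^bsub>1/2\<^esub> B)
    + (2 * r1) *\<^sub>R (A \<sharp>\<^bsub>1/4\<^esub> B) + k *\<^sub>R (A \<sharp>\<^bsub>v\<^esub> B)"
  define f where "f x = (2 * v - 1 - r1) + 0 * x + (- 2 * v - r1) * x powr (1/2)
      + (2 * r1) * x powr (1/4) + k * x powr v" for x
  have f_gap: "f x = x * gap (1 - v) r1 k (1 / x)" if "x > 0" for x
    unfolding gap_reflect[OF that] by (simp add: f_def field_simps)
  have D: "rhs = A \<nabla>\<^bsub>v\<^esub> B + ?D"
    unfolding rhs arith_mean_def by (simp add: algebra_simps flip: scaleR_add_left) (simp add: scaleR_add_left)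
  have range_pos: "x > 0" if "x \<in> {c / b..d / a}" for x
    using that c_pos b_pos by (auto intro: less_le_trans[of 0 "c / b"])
  have range': "h \<le> 1 / x \<or> 1 / x \<le> 1 / h" if "x \<in> {c / b..d / a}" for x
    using range[OF that] range_pos[OF that] h by (auto simp: field_simps)
  have v': "0 < 1 - v" "1 - v \<le> 1/2" using v by auto
  note gap = gap_nonneg_and_pos[OF v' h _ range' r1 r1h k]
  have nonneg: "0 \<le> f x" if "x \<in> {c / b..d / a}" for x
    using gap(1)[OF _ that] range_pos[OF that] by (simp add: f_gap)
  have pos: "0 < f x" if "x \<in> {c / b..d / a}" "x \<noteq> 1" for x
    using gap(2)[OF _ that(1)] range_pos[OF that(1)] that(2) v by (simp add: f_gap)
  show "A \<nabla>\<^bsub>v\<^esub> B \<preceq> rhs"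
    by (rule loewner_leI[OF selfadjoint_arith_mean positive_combination[OF f_def] D]) (rule nonneg)
  assume "A \<nabla>\<^bsub>v\<^esub> B = rhs"
  then have "?D = 0" using D by simp
  then show "A = B" using nonneg pos by (intro combination_eq_0_imp_eq[OF f_def])
qed

end

text \<open>The equality statement assumes only \<open>m \<le> M\<close>, since \<open>m = M\<close>
  could not occur under \<open>m < M\<close>. A nonzero vector excludes the zero space, where all
  operators coincide for any \<open>m\<close> and \<open>M\<close>. The weight
  \<open>v = 1/2\<close> is left out there because \<open>r1\<close> and \<open>r1h\<close> then
  vanish and both sides always agree.\<close>

theorem theorem3p2:
  fixes A B :: "'a::complex_hilbert \<Rightarrow>\<^sub>L 'a"
    and m m' M M' v h r r1 r1h :: real
  assumes separable: "separable_space (euclidean :: 'a topology)"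
    and A: "positive_op A" "invertible_op A"
    and B: "positive_op B" "invertible_op B"
    and pos: "0 < m" "0 < m'" "0 < M" "0 < M'"
    and bounds:
      "(m' *\<^sub>R id_blinfun \<preceq> A \<and> A \<preceq> m *\<^sub>R id_blinfun \<and> M *\<^sub>R id_blinfun \<preceq> B \<and> B \<preceq> M' *\<^sub>R id_blinfun) \<or>
       (m' *\<^sub>R id_blinfun \<preceq> B \<and> B \<preceq> m *\<^sub>R id_blinfun \<and> M *\<^sub>R id_blinfun \<preceq> A \<and> A \<preceq> M' *\<^sub>R id_blinfun)"
    and v: "0 < v" "v < 1"
    and h: "h = M / m"
    and r: "r = min v (1 - v)"
    and r1: "r1 = min (2 * r) (1 - 2 * r)"
    and r1h: "r1h = min (2 * r1) (1 - 2 * r1)"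
  shows
    "(m < M \<longrightarrow>
       (v \<le> 1/2 \<longrightarrow>
          A \<nabla>\<^bsub>v\<^esub> B \<preceq>
            (2 * (1 - v)) *\<^sub>R (A \<nabla>\<^bsub>1/2\<^esub> B - A \<sharp>\<^bsub>1/2\<^esub> B)
            - r1 *\<^sub>R (A \<sharp>\<^bsub>1/2\<^esub> B - 2 *\<^sub>R (A \<sharp>\<^bsub>3/4\<^esub> B) + B)
            + (kantorovich (root 4 h) powr (- r1h)) *\<^sub>R (A \<sharp>\<^bsub>v\<^esub> B)) \<and>
       (1/2 < v \<longrightarrow>
          A \<nabla>\<^bsub>v\<^esub> B \<preceq>
            (2 * v) *\<^sub>R (A \<nabla>\<^bsub>1/2\<^esub> B - A \<sharp>\<^bsub>1/2\<^esub> B)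
            - r1 *\<^sub>R (A \<sharp>\<^bsub>1/2\<^esub> B - 2 *\<^sub>R (A \<sharp>\<^bsub>1/4\<^esub> B) + A)
            + (kantorovich (root 4 h) powr (- r1h)) *\<^sub>R (A \<sharp>\<^bsub>v\<^esub> B))) \<and>
     (m \<le> M \<and> (\<exists>x::'a. x \<noteq> 0) \<longrightarrow>
       (v < 1/2 \<longrightarrow>
          (A \<nabla>\<^bsub>v\<^esub> B =
            (2 * (1 - v)) *\<^sub>R (A \<nabla>\<^bsub>1/2\<^esub> B - A \<sharp>\<^bsub>1/2\<^esub> B)
            - r1 *\<^sub>R (A \<sharp>\<^bsub>1/2\<^esub> B - 2 *\<^sub>R (A \<sharp>\<^bsub>3/4\<^esub> B) + B)
            + (kantorovich (root 4 h) powr (- r1h)) *\<^sub>R (A \<sharp>\<^bsub>v\<^esub> B)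
          \<longleftrightarrow> A = B \<and> m = M)) \<and>
       (1/2 < v \<longrightarrow>
          (A \<nabla>\<^bsub>v\<^esub> B =
            (2 * v) *\<^sub>R (A \<nabla>\<^bsub>1/2\<^esub> B - A \<sharp>\<^bsub>1/2\<^esub> B)
            - r1 *\<^sub>R (A \<sharp>\<^bsub>1/2\<^esub> B - 2 *\<^sub>R (A \<sharp>\<^bsub>1/4\<^esub> B) + A)
            + (kantorovich (root 4 h) powr (- r1h)) *\<^sub>R (A \<sharp>\<^bsub>v\<^esub> B)
          \<longleftrightarrow> A = B \<and> m = M)))"
proof -
  \<comment> \<open>The bounds \<open>a\<close>, \<open>b\<close>, \<open>c\<close>,
    \<open>d\<close> cover both alternatives: \<open>{c / b..d / a}\<close> is
    \<open>{M / m..M' / m'}\<close> in the first and \<open>{m' / M'..m / M}\<close> in the second,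
    hence above \<open>h\<close> or below \<open>1 / h\<close>.\<close>
  have main: ?thesis
    if AB: "form_between a b A" "form_between c d B" and abcd: "a > 0" "b > 0" "c > 0" "d > 0"
      and range: "\<And>x. m \<le> M \<Longrightarrow> x \<in> {c / b..d / a} \<Longrightarrow> h \<le> x \<or> x \<le> 1 / h"
      and eq: "A = B \<Longrightarrow> \<exists>x::'a. x \<noteq> 0 \<Longrightarrow> M \<le> m"
    for a b c d
  proof -
    interpret positive_pair A a b B c d using AB abcd by unfold_locales
    have h1: "1 \<le> h" if "m \<le> M" using that pos by (simp add: h)
    have low: "r1 = min (2 * v) (1 - 2 * v)" if "v \<le> 1/2" using that by (simp add: r1 r)
    have high: "r1 = min (2 * (1 - v)) (1 - 2 * (1 - v))" if "1/2 < v" using that by (simp add: r1 r)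
    note low = reverse_young_low[OF v(1) _ h1 range low r1h refl refl]
    note high = reverse_young_high[OF _ v(2) h1 range high r1h refl refl]
    \<comment> \<open>Here \<open>h = 1\<close>, so with \<open>A = B\<close> every mean is
      \<open>A\<close> and both sides reduce to it.\<close>
    have one: "kantorovich (root 4 h) powr (- r1h) = 1" if "m = M"
      using that pos by (simp add: h kantorovich_def)
    have self: "B \<nabla>\<^bsub>s\<^esub> B = B" for s
      by (simp add: arith_mean_def flip: scaleR_add_left)
    show ?thesis
      apply (intro conjI impI)
      subgoal using low(1) by auto
      subgoal using high(1) by auto
      subgoal
        apply (rule iffI)
        subgoal using low(2) eq by (meson less_imp_le order_antisym)
        subgoal using geom_mean_self one self by (auto simp: scaleR_2)
        done
      subgoal
        apply (rule iffI)
        subgoal using high(2) eq by (meson less_imp_le order_antisym)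
        subgoal using geom_mean_self one self by (auto simp: scaleR_2)
        done
      done
  qed
  show ?thesis using bounds
  proof (elim disjE conjE)
    assume *: "m' *\<^sub>R id_blinfun \<preceq> A" "A \<preceq> m *\<^sub>R id_blinfun" "M *\<^sub>R id_blinfun \<preceq> B" "B \<preceq> M' *\<^sub>R id_blinfun"
    note fb = form_between_loewner[OF *(1,2)] form_between_loewner[OF *(3,4)]
    show ?thesis
    proof (rule main[OF fb])
      \<comment> \<open>At a nonzero vector the common form lies above \<open>M\<close> and below
        \<open>m\<close> times the squared norm.\<close>
      show "M \<le> m" if "A = B" "\<exists>x::'a. x \<noteq> 0"
        using that form_betweenD(3)[OF fb(1)] form_betweenD(2)[OF fb(2)]
        by (metis mult_right_le_imp_le order_trans zero_less_norm_iff zero_less_power)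
    qed (use pos in \<open>auto simp: h\<close>)
  next
    assume *: "m' *\<^sub>R id_blinfun \<preceq> B" "B \<preceq> m *\<^sub>R id_blinfun" "M *\<^sub>R id_blinfun \<preceq> A" "A \<preceq> M' *\<^sub>R id_blinfun"
    note fb = form_between_loewner[OF *(3,4)] form_between_loewner[OF *(1,2)]
    show ?thesis
    proof (rule main[OF fb])
      show "M \<le> m" if "A = B" "\<exists>x::'a. x \<noteq> 0"
        using that form_betweenD(2)[OF fb(1)] form_betweenD(3)[OF fb(2)]
        by (metis mult_right_le_imp_le order_trans zero_less_norm_iff zero_less_power)
    qed (use pos in \<open>auto simp: h\<close>)
  qed
qed

end
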